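(* Grothendieck's complex constants satisfy $$k_G^{\mathbb C}\le K_G^{\mathbb C}\le \frac{k_G^{\mathbb C}}{2-k_G^{\mathbb C}}.$$
   Context: For $v\in\mathbb C^n$, $\Delta_n(v)$ is the diagonal matrix with diagonal $v$; $\|\cdot\|_\infty$ on matrices is the operator norm and on $\mathbb C^n$ the max norm. For a complex $m\times n$ matrix $X$: - $\|X\|_F$ is the norm of $X$ as a linear operator $F_X:(\mathbb C^n,\|\cdot\|_\infty)\to(\mathbb C^m,\|\cdot\|_2)$. - $\|X\|_{cbF}$ is the completely bounded norm of $F_X$ (into the column Hilbert space), concretely $\|X\|_{cbF}=\min\{\|B\|_\infty: X=B\Delta_n(\xi),\ \xi_j\ge0,\ \|\xi\|_2=1\}$. - $\|X\|_S$ is the Schur multiplier norm $\sup\{\|X\circ A\|_\infty:\ A\in M_{(m,n)}(\mathbb C),\ \|A\|_\infty\le1\}$, where $\circ$ is the entrywise product. - $\|X\|_{\wedge(\infty,\infty)}$ is the projective cross norm on $(\mathbb C^m,\|\cdot\|_\infty)\otimes(\mathbb C^n,\|\cdot\|_\infty)$ transported to matrices: $\|X\|_{\wedge(\infty,\infty)}=\inf\{\sum_k\|a_k\|_\infty\|b_k\|_\infty:\ X_{(i,j)}=\sum_k (a_k)_i(b_k)_j\}$, the infimum over finite sums. $k_G^{\mathbb C}$ (the little constant) is the smallest constant $k$ such that $\|X\|_{cbF}\le\sqrt{k}\,\|X\|_F$ for all $m,n$ and all complex $m\times n$ matrices $X$; it is known that $k_G^{\mathbb C}=4/\pi$. $K_G^{\mathbb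 C}$ is the smallest constant $K$ such that $\|X\|_{\wedge(\infty,\infty)}\le K\|X\|_S$ for all $m,n$ and all complex $m\times n$ matrices $X$. By duality, $K_G^{\mathbb C}$ is equivalently the smallest $K$ with $\|X\|_{cbB}\le K\|X\|_B$ for all complex matrices $X$, where $\|X\|_B=\sup\{|\sum_{i,j}X_{(i,j)}a_ib_j|:\|a\|_\infty\le1,\|b\|_\infty\le1\}$ and $\|X\|_{cbB}=\min\{\|B\|_\infty: X=\Delta_m(\eta)B\Delta_n(\xi),\ \eta_i,\xi_j\ge0,\ \|\eta\|_2=\|\xi\|_2=1\}$. *)

theory Defs
  imports "Jordan_Normal_Form.Matrix" "HOL-Analysis.L2_Norm"
begin

definition l2_norm :: "complex vec \<Rightarrow> real" where
  "l2_norm v = L2_set (\<lambda>i. cmod (v $ i)) {..<dim_vec v}"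

(* the 0 only matters for vectors of dimension 0 *)
definition max_norm :: "complex vec \<Rightarrow> real" where
  "max_norm v = Max (insert 0 (cmod ` set\<^sub>v v))"

definition op_norm :: "complex mat \<Rightarrow> real" where
  "op_norm A = Sup {l2_norm (A *\<^sub>v v) | v. v \<in> carrier_vec (dim_col A) \<and> l2_norm v \<le> 1}"

(* norm of X as an operator from (C^n, max norm) to (C^m, Euclidean norm) *)
definition F_norm :: "complex mat \<Rightarrow> real" where
  "F_norm X = Sup {l2_norm (X *\<^sub>v v) | v. v \<in> carrier_vec (dim_col X) \<and> max_norm v \<le> 1}"

(* The infimum is attained, hence a minimum. The diagonal matrix with diagonal xi is mat_diag n xi;
   only the values of xi on {..<n} matter. *)
definition cbF_norm :: "complex mat \<Rightarrow> real" where
  "cbF_norm X = Inf {op_norm B | B (\<xi> :: nat \<Rightarrow> real).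
     B \<in> carrier_mat (dim_row X) (dim_col X) \<and>
     (\<forall>j<dim_col X. 0 \<le> \<xi> j) \<and>
     L2_set \<xi> {..<dim_col X} = 1 \<and>
     X = B * mat_diag (dim_col X) (\<lambda>j. complex_of_real (\<xi> j))}"

definition schur_product :: "complex mat \<Rightarrow> complex mat \<Rightarrow> complex mat" where
  "schur_product X A = mat (dim_row X) (dim_col X) (\<lambda>(i, j). X $$ (i, j) * A $$ (i, j))"

definition schur_norm :: "complex mat \<Rightarrow> real" where
  "schur_norm X = Sup {op_norm (schur_product X A) | A.
     A \<in> carrier_mat (dim_row X) (dim_col X) \<and> op_norm A \<le> 1}"

(* projective cross norm of (C^m, max norm) and (C^n, max norm) *)
definition projective_norm :: "complex mat \<Rightarrow> real" where
  "projective_norm X = Inf {\<Sum>k<r. max_norm (a k) * max_norm (b k) |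
     (r :: nat) (a :: nat \<Rightarrow> complex vec) (b :: nat \<Rightarrow> complex vec).
     (\<forall>k<r. a k \<in> carrier_vec (dim_row X) \<and> b k \<in> carrier_vec (dim_col X)) \<and>
     (\<forall>i<dim_row X. \<forall>j<dim_col X. X $$ (i, j) = (\<Sum>k<r. a k $ i * b k $ j))}"

(* The two constants below are the smallest elements of the respective sets. Matrices have
   m, n > 0; in particular cbF_norm is an infimum over the empty set when n = 0. *)
definition little_grothendieck_constant :: real where
  "little_grothendieck_constant = Inf {k. 0 \<le> k \<and>
     (\<forall>m n X. 0 < m \<longrightarrow> 0 < n \<longrightarrow> X \<in> carrier_mat m n \<longrightarrow>
        cbF_norm X \<le> sqrt k * F_norm X)}"

definition grothendieck_constant :: real where
  "grothendieck_constant = Inf {K.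
     \<forall>m n X. 0 < m \<longrightarrow> 0 < n \<longrightarrow> X \<in> carrier_mat m n \<longrightarrow>
        projective_norm X \<le> K * schur_norm X}"

end

theory Submission
  imports "HOL-Probability.Probability" Defs
begin

text \<open>
  Call \<open>k\<close> admissible if \<open>cbF_norm X \<le> sqrt k * F_norm X\<close> for all \<open>X\<close>, and call \<open>K\<close> admissible if
  \<open>projective_norm X \<le> K * schur_norm X\<close> for all \<open>X\<close>. The theorem compares the infima of the two
  sets of admissible numbers.

  Both inequalities rest on one duality (\<open>diagonal_majorant\<close>). A correlation matrix is the Gram matrix
  of unit vectors. If \<open>A\<close> has a nonnegative diagonal and \<open>Re (\<Sum>i j. A i j * G i j) \<le> t\<close> for every
  correlation matrix \<open>G\<close>, then for each \<open>e > 0\<close> there are weights \<open>z i > 0\<close> of total mass at most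
  \<open>t + e\<close> such that \<open>Re (v\<^sup>* A v) \<le> \<Sum>i. z i * \<bar>v i\<bar>\<^sup>2\<close> for all \<open>v\<close>. No separation theorem is needed: the
  weights are read off from a nearly maximal \<open>G\<close>, because moving \<open>G\<close> towards the rank one matrix of
  \<open>v\<close> cannot increase the pairing by much. Applied to \<open>X\<^sup>* X\<close>, the duality says that the square of
  \<open>cbF_norm X\<close> is the supremum of the pairings of \<open>X\<^sup>* X\<close> with correlation matrices
  (\<open>cbF_norm_le_sqrt\<close>, \<open>pairing_gram_le_cbF_norm\<close>).

  Lower bound: a correlation matrix has Schur norm at most 1, so for admissible \<open>K\<close> its projective
  norm is at most \<open>K\<close>. A rank one matrix \<open>a i * b j\<close> pairs with \<open>X\<^sup>* X\<close> to at most
  \<open>\<parallel>a\<parallel> \<parallel>b\<parallel> (F_norm X)\<^sup>2\<close>; hence \<open>(cbF_norm X)\<^sup>2 \<le> K (F_norm X)\<^sup>2\<close>, and \<open>K\<close> is admissible for the little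
  problem (\<open>little_bound_of_grothendieck_bound\<close>).

  Upper bound: let \<open>k < 2\<close> be admissible for the little problem, let \<open>Y\<close> be a matrix whose bilinear
  form is bounded by \<open>\<beta>\<close> on max-norm unit vectors, and let \<open>H\<close> be the Hermitian matrix with zero
  diagonal blocks and off-diagonal blocks \<open>Y / 2\<close>, \<open>Y\<^sup>* / 2\<close>. Let \<open>M\<close> be the supremum of the pairings
  of \<open>H\<close> with correlation matrices, and \<open>z\<close> weights of total mass \<open>S\<close> that majorise \<open>H\<close>, where \<open>S\<close> is
  close to \<open>M\<close>. Then \<open>Diag z - H\<close> is positive semidefinite, say equal to \<open>R\<^sup>* R\<close>, and
  \<open>(F_norm R)\<^sup>2 \<le> S + \<beta>\<close>. The pairings of \<open>R\<^sup>* R\<close> with correlation matrices, whose off-diagonal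
  blocks may be negated, give \<open>S + M \<le> k (S + \<beta>)\<close>, that is, \<open>(2 - k) S \<le> k \<beta>\<close> up to an arbitrarily
  small error (\<open>bilinear_majorant\<close>). The weights \<open>z\<close> factor \<open>Y\<close> through a contraction, so
  \<open>Re (\<Sum>i j. Y i j * X i j) \<le> S * schur_norm X\<close> for every \<open>X\<close>, and separating a matrix from a
  multiple of the projective unit ball turns this into
  \<open>projective_norm X \<le> k / (2 - k) * schur_norm X\<close> (\<open>projective_norm_le_schur_norm\<close>).

  This needs the little constant to be smaller than 2. Complex combinations of independent real
  Gaussian variables show that \<open>pi / 2\<close> is admissible for the little problem
  (\<open>little_bound_half_pi\<close>). Finally, the infimum of the admissible \<open>k\<close> is itself admissible.
\<close>

section \<open>Norms in terms of coordinates\<close>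

(* The infix dollar is reserved for the entries of a vector of type complex vec. *)
unbundle no vec_syntax

text \<open>The Euclidean norm of the first \<open>n\<close> coordinates of a sequence.\<close>
definition enorm :: "nat \<Rightarrow> (nat \<Rightarrow> complex) \<Rightarrow> real" where
  "enorm n v = L2_set (\<lambda>i. cmod (v i)) {..<n}"

text \<open>
  The product of a matrix with \<open>n\<close> columns and a vector. Matrices and vectors are functions on the
  natural numbers; only their values below the dimensions matter.
\<close>
definition mulv :: "nat \<Rightarrow> (nat \<Rightarrow> nat \<Rightarrow> complex) \<Rightarrow> (nat \<Rightarrow> complex) \<Rightarrow> nat \<Rightarrow> complex" where
  "mulv n A v = (\<lambda>i. \<Sum>j<n. A i j * v j)"

abbreviation entry :: "complex mat \<Rightarrow> nat \<Rightarrow> nat \<Rightarrow> complex" where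
  "entry X i j \<equiv> X $$ (i, j)"

lemma Re_cnj_mult_self: "Re (cnj z * z) = (cmod z)\<^sup>2"
  by (simp only: cmod_power2) (simp add: power2_eq_square)

lemma enorm_nonneg [simp]: "0 \<le> enorm n v"
  by (simp add: enorm_def)

lemma enorm_sq: "(enorm n v)\<^sup>2 = (\<Sum>i<n. (cmod (v i))\<^sup>2)"
  by (simp add: enorm_def L2_set_def sum_nonneg)

lemma enorm_cong: "(\<And>i. i < n \<Longrightarrow> v i = w i) \<Longrightarrow> enorm n v = enorm n w"
  by (auto simp: enorm_def intro!: L2_set_cong)

lemma enorm_scale: "enorm n (\<lambda>i. c * v i) = cmod c * enorm n v"
  by (simp add: enorm_def norm_mult L2_set_right_distrib)

lemma enorm_cnj [simp]: "enorm n (\<lambda>i. cnj (v i)) = enorm n v"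
  by (simp add: enorm_def)

lemma enorm_eq_0: "enorm n v = 0 \<longleftrightarrow> (\<forall>i<n. v i = 0)"
  by (auto simp: enorm_def L2_set_eq_0_iff)

lemma norm_le_enorm: "i < n \<Longrightarrow> cmod (v i) \<le> enorm n v"
  by (auto simp: enorm_def intro!: member_le_L2_set)

lemma enorm_cauchy_schwarz: "cmod (\<Sum>i<n. v i * w i) \<le> enorm n v * enorm n w"
proof -
  have "cmod (\<Sum>i<n. v i * w i) \<le> (\<Sum>i<n. \<bar>cmod (v i)\<bar> * \<bar>cmod (w i)\<bar>)"
    by (rule order_trans[OF norm_sum]) (simp add: norm_mult)
  also have "\<dots> \<le> enorm n v * enorm n w"
    unfolding enorm_def by (rule L2_set_mult_ineq)
  finally show ?thesis .
qed

lemma mulv_cong: "(\<And>j. j < n \<Longrightarrow> A i j = B i j) \<Longrightarrow> (\<And>j. j < n \<Longrightarrow> v j = w j) \<Longrightarrow>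
  mulv n A v i = mulv n B w i"
  by (simp add: mulv_def)

lemma mulv_scale: "mulv n A (\<lambda>j. c * v j) = (\<lambda>i. c * mulv n A v i)"
  by (auto simp: mulv_def sum_distrib_left algebra_simps)

lemma enorm_mulv_le:
  assumes "\<And>j. j < n \<Longrightarrow> cmod (v j) \<le> 1"
  shows "enorm m (mulv n A v) \<le> (\<Sum>i<m. \<Sum>j<n. cmod (A i j))"
proof -
  have "enorm m (mulv n A v) \<le> (\<Sum>i<m. \<bar>cmod (mulv n A v i)\<bar>)"
    unfolding enorm_def by (rule L2_set_le_sum_abs)
  also have "\<dots> \<le> (\<Sum>i<m. \<Sum>j<n. cmod (A i j))"
    unfolding mulv_def
    by (auto intro!: sum_mono sum_norm_le simp: norm_mult mult_left_le assms)
  finally show ?thesis .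
qed

lemma l2_norm_eq: "l2_norm v = enorm (dim_vec v) (($) v)"
  by (simp add: l2_norm_def enorm_def)

lemma l2_norm_mult_mat_vec:
  assumes "A \<in> carrier_mat m n" "v \<in> carrier_vec n"
  shows "l2_norm (A *\<^sub>v v) = enorm m (mulv n (entry A) (($) v))"
  using assms by (auto simp: l2_norm_eq mulv_def scalar_prod_def lessThan_atLeast0 intro!: enorm_cong sum.cong)

lemma max_norm_le_iff:
  "0 \<le> c \<Longrightarrow> max_norm v \<le> c \<longleftrightarrow> (\<forall>i<dim_vec v. cmod (v $ i) \<le> c)"
  by (auto simp: max_norm_def vec_set_def)

lemma max_norm_nonneg: "0 \<le> max_norm v"
  by (simp add: max_norm_def vec_set_def)

lemma norm_le_max_norm: "i < dim_vec v \<Longrightarrow> cmod (v $ i) \<le> max_norm v"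
  using max_norm_le_iff[OF max_norm_nonneg, of v v] by blast

lemma bdd_above_op_norm:
  assumes A: "A \<in> carrier_mat m n"
  shows "bdd_above {l2_norm (A *\<^sub>v v) | v. v \<in> carrier_vec (dim_col A) \<and> l2_norm v \<le> 1}"
proof (rule bdd_aboveI)
  fix x assume "x \<in> {l2_norm (A *\<^sub>v v) | v. v \<in> carrier_vec (dim_col A) \<and> l2_norm v \<le> 1}"
  then obtain v where v: "x = l2_norm (A *\<^sub>v v)" "v \<in> carrier_vec n" "l2_norm v \<le> 1"
    using A by auto
  have "cmod (v $ j) \<le> 1" if "j < n" for j
    using norm_le_enorm[of j n "($) v"] v that by (auto simp: l2_norm_eq)
  then show "x \<le> (\<Sum>i<m. \<Sum>j<n. cmod (entry A i j))"
    using enorm_mulv_le v A by (simp add: l2_norm_mult_mat_vec)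
qed

lemma op_norm_nonneg:
  assumes A: "A \<in> carrier_mat m n"
  shows "0 \<le> op_norm A"
proof -
  have "l2_norm (A *\<^sub>v 0\<^sub>v n) \<le> op_norm A"
    unfolding op_norm_def using A
    by (intro cSup_upper bdd_above_op_norm[OF A]) (auto simp: l2_norm_def L2_set_def intro!: exI[of _ "0\<^sub>v n"])
  moreover have "0 \<le> l2_norm (A *\<^sub>v 0\<^sub>v n)" by (simp add: l2_norm_def)
  ultimately show ?thesis by linarith
qed

lemma op_norm_upper:
  assumes A: "A \<in> carrier_mat m n"
  shows "enorm m (mulv n (entry A) v) \<le> op_norm A * enorm n v"
proof (cases "enorm n v = 0")
  case True
  then have "enorm m (mulv n (entry A) v) = 0" by (auto simp: enorm_eq_0 mulv_def)
  then show ?thesis using True by simp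
next
  case False
  define w where "w = vec n (\<lambda>j. complex_of_real (inverse (enorm n v)) * v j)"
  have w: "w \<in> carrier_vec n" by (simp add: w_def)
  have "l2_norm w = enorm n (\<lambda>j. complex_of_real (inverse (enorm n v)) * v j)"
    using w by (auto simp: l2_norm_eq w_def intro!: enorm_cong)
  also have "\<dots> = 1" using False by (simp only: enorm_scale norm_of_real) simp
  finally have w1: "l2_norm w = 1" .
  have "l2_norm (A *\<^sub>v w) = enorm m (mulv n (entry A) (\<lambda>j. complex_of_real (inverse (enorm n v)) * v j))"
    unfolding l2_norm_mult_mat_vec[OF A w] by (intro enorm_cong mulv_cong) (auto simp: w_def)
  also have "\<dots> = inverse (enorm n v) * enorm m (mulv n (entry A) v)"
    by (simp add: mulv_scale enorm_scale norm_inverse)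
  finally have eq: "l2_norm (A *\<^sub>v w) = inverse (enorm n v) * enorm m (mulv n (entry A) v)" .
  have "l2_norm (A *\<^sub>v w) \<le> op_norm A"
    unfolding op_norm_def using A w w1 by (intro cSup_upper bdd_above_op_norm[OF A]) auto
  moreover have "0 < enorm n v" using False enorm_nonneg[of n v] by linarith
  ultimately show ?thesis unfolding eq by (simp add: field_simps)
qed

lemma op_norm_least:
  assumes A: "A \<in> carrier_mat m n" and c: "0 \<le> c"
    and le: "\<And>v. enorm m (mulv n (entry A) v) \<le> c * enorm n v"
  shows "op_norm A \<le> c"
  unfolding op_norm_def
proof (rule cSup_least)
  show "{l2_norm (A *\<^sub>v v) | v. v \<in> carrier_vec (dim_col A) \<and> l2_norm v \<le> 1} \<noteq> {}"
    using A by (auto simp: l2_norm_def L2_set_def intro!: exI[of _ "0\<^sub>v n"])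
  fix x assume "x \<in> {l2_norm (A *\<^sub>v v) | v. v \<in> carrier_vec (dim_col A) \<and> l2_norm v \<le> 1}"
  then obtain v where v: "x = l2_norm (A *\<^sub>v v)" "v \<in> carrier_vec n" "l2_norm v \<le> 1"
    using A by auto
  have "x \<le> c * enorm n (($) v)" using v le l2_norm_mult_mat_vec[OF A v(2)] by simp
  also have "\<dots> \<le> c * 1" using v c by (intro mult_left_mono) (auto simp: l2_norm_eq)
  finally show "x \<le> c" by simp
qed

lemma norm_entry_le_op_norm:
  assumes A: "A \<in> carrier_mat m n" and ij: "i < m" "j < n"
  shows "cmod (entry A i j) \<le> op_norm A"
proof -
  define v where "v = (\<lambda>k. if k = j then 1 else 0 :: complex)"
  have "(enorm n v)\<^sup>2 = (\<Sum>k<n. if k = j then 1 else 0)"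
    unfolding enorm_sq by (intro sum.cong) (auto simp: v_def)
  then have v: "enorm n v = 1" using ij by (simp add: power2_eq_1_iff) (smt (verit) enorm_nonneg)
  have "mulv n (entry A) v i = (\<Sum>k<n. if k = j then entry A i j else 0)"
    unfolding mulv_def by (intro sum.cong) (auto simp: v_def)
  then have "mulv n (entry A) v i = entry A i j" using ij by simp
  then show ?thesis using norm_le_enorm[OF ij(1), of "mulv n (entry A) v"] op_norm_upper[OF A, of v] v by simp
qed

lemma bdd_above_F_norm:
  assumes A: "A \<in> carrier_mat m n"
  shows "bdd_above {l2_norm (A *\<^sub>v v) | v. v \<in> carrier_vec (dim_col A) \<and> max_norm v \<le> 1}"
proof (rule bdd_aboveI)
  fix x assume "x \<in> {l2_norm (A *\<^sub>v v) | v. v \<in> carrier_vec (dim_col A) \<and> max_norm v \<le> 1}"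
  then obtain v where v: "x = l2_norm (A *\<^sub>v v)" "v \<in> carrier_vec n" "max_norm v \<le> 1"
    using A by auto
  then show "x \<le> (\<Sum>i<m. \<Sum>j<n. cmod (entry A i j))"
    using enorm_mulv_le A by (simp add: l2_norm_mult_mat_vec max_norm_le_iff)
qed

lemma F_norm_upper_unit:
  assumes A: "A \<in> carrier_mat m n" and v: "\<And>j. j < n \<Longrightarrow> cmod (v j) \<le> 1"
  shows "enorm m (mulv n (entry A) v) \<le> F_norm A"
proof -
  have "enorm m (mulv n (entry A) v) = l2_norm (A *\<^sub>v vec n v)"
    unfolding l2_norm_mult_mat_vec[OF A vec_carrier] by (intro enorm_cong mulv_cong) auto
  also have "\<dots> \<le> F_norm A"
    unfolding F_norm_def using A v
    by (intro cSup_upper bdd_above_F_norm[OF A]) (auto simp: max_norm_le_iff)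
  finally show ?thesis .
qed

lemma F_norm_nonneg: "A \<in> carrier_mat m n \<Longrightarrow> 0 \<le> F_norm A"
  using order_trans[OF enorm_nonneg F_norm_upper_unit[of A m n "\<lambda>_. 0"]] by simp

lemma F_norm_upper:
  assumes A: "A \<in> carrier_mat m n" and v: "\<And>j. j < n \<Longrightarrow> cmod (v j) \<le> s" and s: "0 \<le> s"
  shows "enorm m (mulv n (entry A) v) \<le> s * F_norm A"
proof (cases "s = 0")
  case True
  then have "enorm m (mulv n (entry A) v) = 0" using v by (auto simp: enorm_eq_0 mulv_def)
  then show ?thesis using True by simp
next
  case False
  then have s: "0 < s" using s by simp
  have "enorm m (mulv n (entry A) (\<lambda>j. complex_of_real (inverse s) * v j)) \<le> F_norm A"
    using s v by (intro F_norm_upper_unit[OF A]) (auto simp: norm_divide field_simps)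
  then have "inverse s * enorm m (mulv n (entry A) v) \<le> F_norm A"
    using s by (simp only: mulv_scale enorm_scale norm_of_real) simp
  then show ?thesis using s by (simp add: field_simps)
qed

lemma F_norm_least:
  assumes A: "A \<in> carrier_mat m n"
    and le: "\<And>v. (\<And>j. j < n \<Longrightarrow> cmod (v j) \<le> 1) \<Longrightarrow> enorm m (mulv n (entry A) v) \<le> c"
  shows "F_norm A \<le> c"
  unfolding F_norm_def
proof (rule cSup_least)
  show "{l2_norm (A *\<^sub>v v) | v. v \<in> carrier_vec (dim_col A) \<and> max_norm v \<le> 1} \<noteq> {}"
    using A by (auto simp: max_norm_le_iff intro!: exI[of _ "0\<^sub>v n"])
  fix x assume "x \<in> {l2_norm (A *\<^sub>v v) | v. v \<in> carrier_vec (dim_col A) \<and> max_norm v \<le> 1}"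
  then obtain v where v: "x = l2_norm (A *\<^sub>v v)" "v \<in> carrier_vec n" "max_norm v \<le> 1"
    using A by auto
  then show "x \<le> c" using le[of "($) v"] A by (simp add: l2_norm_mult_mat_vec max_norm_le_iff)
qed

section \<open>Correlation matrices and diagonal majorants\<close>

text \<open>
  Correlation matrices of size \<open>N\<close>: Gram matrices of \<open>N\<close> unit vectors in some \<open>\<complex>\<^sup>r\<close>. The \<open>i\<close>-th vector
  has the coordinates \<open>V k i\<close> for \<open>k < r\<close>.
\<close>
definition correlation :: "nat \<Rightarrow> (nat \<Rightarrow> nat \<Rightarrow> complex) \<Rightarrow> bool" where
  "correlation N G \<longleftrightarrow> (\<exists>r (V :: nat \<Rightarrow> nat \<Rightarrow> complex).
     (\<forall>i<N. (\<Sum>k<r. (cmod (V k i))\<^sup>2) = 1) \<and>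
     (\<forall>i<N. \<forall>j<N. G i j = (\<Sum>k<r. cnj (V k i) * V k j)))"

text \<open>The real bilinear pairing of two matrices of size \<open>N\<close>, without complex conjugation.\<close>
definition pairing :: "nat \<Rightarrow> (nat \<Rightarrow> nat \<Rightarrow> complex) \<Rightarrow> (nat \<Rightarrow> nat \<Rightarrow> complex) \<Rightarrow> real" where
  "pairing N A G = (\<Sum>i<N. \<Sum>j<N. Re (A i j * G i j))"

text \<open>The real part of the quadratic form \<open>v\<^sup>* A v\<close>.\<close>
definition quad :: "nat \<Rightarrow> (nat \<Rightarrow> nat \<Rightarrow> complex) \<Rightarrow> (nat \<Rightarrow> complex) \<Rightarrow> real" where
  "quad N A v = pairing N A (\<lambda>i j. cnj (v i) * v j)"

lemma correlation_id: "correlation N (\<lambda>i j. if i = j then 1 else 0)"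
proof -
  define V where "V = (\<lambda>(k::nat) (i::nat). if k = i then 1 else 0 :: complex)"
  have "(\<Sum>k<N. (cmod (V k i))\<^sup>2) = 1" if "i < N" for i
  proof -
    have "(\<Sum>k<N. (cmod (V k i))\<^sup>2) = (\<Sum>k<N. if k = i then 1 else 0)"
      by (intro sum.cong) (auto simp: V_def)
    then show ?thesis using that by simp
  qed
  moreover have "(if i = j then 1 else 0) = (\<Sum>k<N. cnj (V k i) * V k j)" if "i < N" "j < N" for i j
  proof -
    have "(\<Sum>k<N. cnj (V k i) * V k j) = (\<Sum>k<N. if k = i then if i = j then 1 else 0 else 0)"
      by (intro sum.cong) (auto simp: V_def)
    then show ?thesis using that by simp
  qed
  ultimately show ?thesis unfolding correlation_def by (intro exI[of _ N] exI[of _ V]) blast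
qed

lemma correlation_norm_le:
  assumes "correlation N G" "i < N" "j < N"
  shows "cmod (G i j) \<le> 1"
proof -
  obtain r and V :: "nat \<Rightarrow> nat \<Rightarrow> complex" where V: "\<forall>i<N. (\<Sum>k<r. (cmod (V k i))\<^sup>2) = 1"
    and G: "\<forall>i<N. \<forall>j<N. G i j = (\<Sum>k<r. cnj (V k i) * V k j)"
    using assms unfolding correlation_def by blast
  have 1: "enorm r (\<lambda>k. V k i) = 1" if "i < N" for i
    using V that by (simp add: enorm_def L2_set_def)
  have "cmod (G i j) \<le> enorm r (\<lambda>k. cnj (V k i)) * enorm r (\<lambda>k. V k j)"
    using G assms enorm_cauchy_schwarz[of "\<lambda>k. cnj (V k i)" "\<lambda>k. V k j" r] by simp
  then show ?thesis using 1 assms by simp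
qed

lemma abs_pairing_le:
  assumes "correlation N G"
  shows "\<bar>pairing N A G\<bar> \<le> (\<Sum>i<N. \<Sum>j<N. cmod (A i j))"
  unfolding pairing_def
proof (rule order_trans[OF sum_abs], intro sum_mono order_trans[OF sum_abs])
  fix i j assume "i \<in> {..<N}" "j \<in> {..<N}"
  then have "cmod (A i j * G i j) \<le> cmod (A i j) * 1"
    unfolding norm_mult using correlation_norm_le[OF assms] by (intro mult_left_mono) auto
  then show "\<bar>Re (A i j * G i j)\<bar> \<le> cmod (A i j)"
    using abs_Re_le_cmod[of "A i j * G i j"] by linarith
qed

lemma quad_scale: "quad N A (\<lambda>i. complex_of_real c * v i) = c\<^sup>2 * quad N A v"
  unfolding quad_def pairing_def sum_distrib_left
  by (intro sum.cong refl) (simp add: power2_eq_square algebra_simps)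

lemma pairing_sum: "pairing N A (\<lambda>i j. \<Sum>k<r. G k i j) = (\<Sum>k<r. pairing N A (G k))"
  unfolding pairing_def sum_distrib_left Re_sum
  by (subst (2) sum.swap, subst sum.swap, rule refl)

lemma pairing_cong: "(\<And>i j. i < N \<Longrightarrow> j < N \<Longrightarrow> A i j = B i j) \<Longrightarrow>
   (\<And>i j. i < N \<Longrightarrow> j < N \<Longrightarrow> G i j = H i j) \<Longrightarrow> pairing N A G = pairing N B H"
  unfolding pairing_def by (intro sum.cong) auto

lemma pairing_gram:
  assumes "\<And>i j. i < N \<Longrightarrow> j < N \<Longrightarrow> G i j = (\<Sum>k<r. cnj (V k i) * V k j)"
  shows "pairing N A G = (\<Sum>k<r. quad N A (V k))"
  unfolding quad_def pairing_sum[symmetric] using assms by (intro pairing_cong) auto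

lemma quad_diag:
  assumes "\<And>i j. i < N \<Longrightarrow> j < N \<Longrightarrow> A i j = (if i = j then complex_of_real (d i) else 0)"
  shows "quad N A v = (\<Sum>i<N. d i * (cmod (v i))\<^sup>2)"
proof -
  have sq: "Re (complex_of_real c * (cnj a * a)) = c * (cmod a)\<^sup>2" for c a
    by (simp only: cmod_power2) (simp add: power2_eq_square)
  have "quad N A v = (\<Sum>i<N. \<Sum>j<N. if j = i then d i * (cmod (v i))\<^sup>2 else 0)"
    unfolding quad_def pairing_def
    by (intro sum.cong refl) (auto simp only: assms sq lessThan_iff if_True if_False split: if_splits, auto)
  then show ?thesis by simp
qed

text \<open>Second-order accuracy of the first-order expansion, uniformly on the unit square.\<close>
lemma sqrt_mult_taylor:
  fixes x y e :: real
  assumes "0 \<le> x" "x \<le> 1" "0 \<le> y" "y \<le> 1" "0 \<le> e" "e \<le> 1/2"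
  shows "\<bar>sqrt (1 - e * x) * sqrt (1 - e * y) - (1 - e * ((x + y) / 2))\<bar> \<le> e\<^sup>2 / 2"
proof -
  define p q where "p = sqrt (1 - e * x)" and "q = sqrt (1 - e * y)"
  have ex: "e * x \<le> 1/2" "e * y \<le> 1/2" "0 \<le> e * x" "0 \<le> e * y"
    using assms mult_mono[of e "1/2" x 1] mult_mono[of e "1/2" y 1] by auto
  then have p2: "p\<^sup>2 = 1 - e * x" "q\<^sup>2 = 1 - e * y" by (auto simp: p_def q_def)
  have "1/2 \<le> p" "1/2 \<le> q"
    unfolding p_def q_def using ex by (intro real_le_rsqrt; simp add: power2_eq_square)+
  then have pq: "1 \<le> p + q" by simp
  have "\<bar>p - q\<bar> * 1 \<le> \<bar>p - q\<bar> * (p + q)" using pq by (intro mult_left_mono) auto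
  also have "\<dots> = \<bar>p\<^sup>2 - q\<^sup>2\<bar>" using pq by (simp add: power2_eq_square square_diff_square_factored abs_mult)
  also have "\<dots> = \<bar>e * (y - x)\<bar>" unfolding p2 by (simp add: algebra_simps)
  also have "\<dots> \<le> e * 1" unfolding abs_mult using assms by (intro mult_mono) auto
  finally have "(p - q)\<^sup>2 \<le> e\<^sup>2" using assms by (simp add: abs_le_square_iff[symmetric])
  moreover have "p * q - (1 - e * ((x + y) / 2)) = - (p - q)\<^sup>2 / 2"
  proof -
    have "e * ((x + y) / 2) = (2 - p\<^sup>2 - q\<^sup>2) / 2" unfolding p2 by (simp add: field_simps)
    then show ?thesis by (simp add: power2_diff field_simps)
  qed
  ultimately show ?thesis unfolding p_def[symmetric] q_def[symmetric] by simp
qed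

text \<open>
  The perturbation of \<open>G\<close> towards the rank one matrix of \<open>v\<close> that keeps the diagonal equal to 1: adding
  \<open>e v v\<^sup>*\<close> corresponds to one more coordinate \<open>sqrt e * v i\<close> of the underlying vectors, whose old
  coordinates are shrunk accordingly.
\<close>
lemma correlation_perturb:
  assumes G: "correlation N G" and e: "0 \<le> e" "e \<le> 1"
    and v: "\<And>i. i < N \<Longrightarrow> cmod (v i) \<le> 1"
  shows "correlation N (\<lambda>i j. complex_of_real (sqrt (1 - e * (cmod (v i))\<^sup>2) * sqrt (1 - e * (cmod (v j))\<^sup>2)) * G i j
     + complex_of_real e * (cnj (v i) * v j))"
proof -
  obtain r and V :: "nat \<Rightarrow> nat \<Rightarrow> complex" where V: "\<forall>i<N. (\<Sum>k<r. (cmod (V k i))\<^sup>2) = 1"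
    and G: "\<forall>i<N. \<forall>j<N. G i j = (\<Sum>k<r. cnj (V k i) * V k j)"
    using assms unfolding correlation_def by blast
  define d where "d = (\<lambda>i. sqrt (1 - e * (cmod (v i))\<^sup>2))"
  have d: "(d i)\<^sup>2 = 1 - e * (cmod (v i))\<^sup>2" if "i < N" for i
    using mult_mono[of e 1 "(cmod (v i))\<^sup>2" 1] v[OF that] e by (simp add: d_def power_le_one)
  define W where "W = (\<lambda>k i. if k < r then complex_of_real (d i) * V k i else complex_of_real (sqrt e) * v i)"
  have "(\<Sum>k<Suc r. (cmod (W k i))\<^sup>2) = 1" if i: "i < N" for i
  proof -
    have "(\<Sum>k<r. (cmod (W k i))\<^sup>2) = (d i)\<^sup>2 * (\<Sum>k<r. (cmod (V k i))\<^sup>2)"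
      unfolding sum_distrib_left by (intro sum.cong) (auto simp: W_def norm_mult power_mult_distrib)
    then show ?thesis using V i d[OF i] e by (simp add: W_def norm_mult power_mult_distrib)
  qed
  moreover have "complex_of_real (d i * d j) * G i j + complex_of_real e * (cnj (v i) * v j)
     = (\<Sum>k<Suc r. cnj (W k i) * W k j)" if "i < N" "j < N" for i j
  proof -
    have "(\<Sum>k<r. cnj (W k i) * W k j) = complex_of_real (d i * d j) * G i j"
      using G that by (auto simp: W_def sum_distrib_left algebra_simps intro!: sum.cong)
    moreover have "cnj (W r i) * W r j = complex_of_real (sqrt e * sqrt e) * (cnj (v i) * v j)"
      unfolding of_real_mult by (simp add: W_def)
    ultimately show ?thesis using e by simp
  qed
  ultimately show ?thesis unfolding correlation_def d_def by (intro exI[of _ "Suc r"] exI[of _ W]) blast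
qed

text \<open>
  The key duality. For a nearly optimal \<open>G\<close> the weights are
  \<open>\<Sum>j. Re (A i j * G i j + A j i * G j i) / 2\<close> plus a small constant that absorbs the errors and makes
  them positive.
\<close>
lemma diagonal_majorant:
  assumes diag: "\<And>i. i < N \<Longrightarrow> 0 \<le> Re (A i i)"
    and bound: "\<And>G. correlation N G \<Longrightarrow> pairing N A G \<le> t"
    and e: "0 < e"
  obtains z where "\<And>i. i < N \<Longrightarrow> 0 < z i" "(\<Sum>i<N. z i) \<le> t + e"
    "\<And>v. quad N A v \<le> (\<Sum>i<N. z i * (cmod (v i))\<^sup>2)"
proof -
  define C where "C = (\<Sum>i<N. \<Sum>j<N. cmod (A i j))"
  have C: "0 \<le> C" unfolding C_def by (intro sum_nonneg) auto
  define \<epsilon> where "\<epsilon> = min (1/2) (e / (2 * (real N + 1) * (1 + C)))"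
  have \<epsilon>: "0 < \<epsilon>" "\<epsilon> \<le> 1/2" unfolding \<epsilon>_def using e C by (simp, intro min.cobounded1)
  have "\<epsilon> \<le> e / (2 * (real N + 1) * (1 + C))" by (simp add: \<epsilon>_def)
  then have "\<epsilon> * (2 * (real N + 1) * (1 + C)) \<le> e" using C by (simp add: pos_le_divide_eq)
  moreover have "\<epsilon> * (2 * real N * (1 + C)) \<le> \<epsilon> * (2 * (real N + 1) * (1 + C))"
    using \<epsilon> C by (intro mult_left_mono mult_right_mono) auto
  ultimately have \<epsilon>e: "\<epsilon> * (2 * real N * (1 + C)) \<le> e" by linarith
  define s where "s = Sup {pairing N A G |G. correlation N G}"
  have ne: "{pairing N A G |G. correlation N G} \<noteq> {}" using correlation_id by blast
  have bdd: "bdd_above {pairing N A G |G. correlation N G}" using bound by (intro bdd_aboveI) auto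
  obtain G where G: "correlation N G" and Gs: "s - \<epsilon>\<^sup>2 < pairing N A G"
    using less_cSup_iff[OF ne bdd, of "s - \<epsilon>\<^sup>2"] \<epsilon> unfolding s_def by auto
  have opt: "pairing N A G' \<le> pairing N A G + \<epsilon>\<^sup>2" if "correlation N G'" for G'
  proof -
    have "pairing N A G' \<le> s" unfolding s_def using that by (intro cSup_upper bdd) blast
    then show ?thesis using Gs by linarith
  qed
  define R where "R = (\<lambda>i j. Re (A i j * G i j))"
  have RA: "\<bar>R i j\<bar> \<le> cmod (A i j)" if "i < N" "j < N" for i j
  proof -
    have "\<bar>R i j\<bar> \<le> cmod (A i j) * cmod (G i j)"
      unfolding R_def using abs_Re_le_cmod[of "A i j * G i j"] by (simp add: norm_mult)
    also have "\<dots> \<le> cmod (A i j) * 1"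
      using correlation_norm_le[OF G that] by (intro mult_left_mono) auto
    finally show ?thesis by simp
  qed
  define \<mu> where "\<mu> = (\<lambda>i. \<Sum>j<N. (R i j + R j i) / 2)"
  have \<mu>: "(\<Sum>i<N. x i * \<mu> i) = (\<Sum>i<N. \<Sum>j<N. R i j * ((x i + x j) / 2))" for x
  proof -
    have "(\<Sum>i<N. x i * \<mu> i) = (\<Sum>i<N. \<Sum>j<N. x i * R i j / 2) + (\<Sum>i<N. \<Sum>j<N. x i * R j i / 2)"
      unfolding \<mu>_def sum_distrib_left sum.distrib[symmetric]
      by (intro sum.cong refl) (simp add: field_simps)
    also have "(\<Sum>i<N. \<Sum>j<N. x i * R j i / 2) = (\<Sum>i<N. \<Sum>j<N. x j * R i j / 2)"
      by (rule sum.swap)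
    also have "(\<Sum>i<N. \<Sum>j<N. x i * R i j / 2) + \<dots> = (\<Sum>i<N. \<Sum>j<N. R i j * ((x i + x j) / 2))"
      unfolding sum.distrib[symmetric] by (intro sum.cong refl) (simp add: field_simps)
    finally show ?thesis .
  qed
  \<comment> \<open>The first-order condition at the nearly optimal \<open>G\<close>: with step size \<open>\<epsilon>\<close>, both the optimality
      gap \<open>\<epsilon>\<^sup>2\<close> and the second-order error cost only \<open>O(\<epsilon>)\<close> after division by \<open>\<epsilon>\<close>.\<close>
  have small: "quad N A v \<le> (\<Sum>i<N. \<mu> i * (cmod (v i))\<^sup>2) + \<epsilon> * (1 + C)"
    if v: "\<And>i. i < N \<Longrightarrow> cmod (v i) \<le> 1" for v
  proof -
    define x where "x = (\<lambda>i. (cmod (v i))\<^sup>2)"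
    have x: "0 \<le> x i" "x i \<le> 1" if "i < N" for i using v that by (auto simp: x_def power_le_one)
    define G' where "G' = (\<lambda>i j. complex_of_real (sqrt (1 - \<epsilon> * x i) * sqrt (1 - \<epsilon> * x j)) * G i j
        + complex_of_real \<epsilon> * (cnj (v i) * v j))"
    have "correlation N G'" unfolding G'_def x_def using \<epsilon> v by (intro correlation_perturb G) auto
    then have "pairing N A G' \<le> pairing N A G + \<epsilon>\<^sup>2" by (rule opt)
    moreover have "pairing N A G - \<epsilon> * (\<Sum>i<N. x i * \<mu> i) - \<epsilon>\<^sup>2 / 2 * C + \<epsilon> * quad N A v \<le> pairing N A G'"
    proof -
      have "pairing N A G - \<epsilon> * (\<Sum>i<N. x i * \<mu> i) - \<epsilon>\<^sup>2 / 2 * C + \<epsilon> * quad N A v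
         = (\<Sum>i<N. \<Sum>j<N. R i j - \<epsilon> * (R i j * ((x i + x j) / 2)) - \<epsilon>\<^sup>2 / 2 * cmod (A i j) + \<epsilon> * Re (A i j * (cnj (v i) * v j)))"
        unfolding \<mu> unfolding C_def quad_def pairing_def sum.distrib sum_subtractf sum_distrib_left R_def ..
      also have "\<dots> \<le> pairing N A G'"
        unfolding pairing_def
      proof (intro sum_mono)
        fix i j assume "i \<in> {..<N}" "j \<in> {..<N}"
        then have ij: "i < N" "j < N" by auto
        define c where "c = sqrt (1 - \<epsilon> * x i) * sqrt (1 - \<epsilon> * x j)"
        have c: "\<bar>c - (1 - \<epsilon> * ((x i + x j) / 2))\<bar> \<le> \<epsilon>\<^sup>2 / 2"
          unfolding c_def using x ij \<epsilon> by (intro sqrt_mult_taylor) auto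
        have "\<bar>(c - (1 - \<epsilon> * ((x i + x j) / 2))) * R i j\<bar> \<le> \<epsilon>\<^sup>2 / 2 * cmod (A i j)"
          unfolding abs_mult using c RA[OF ij] by (intro mult_mono) auto
        moreover have split: "(c - (1 - \<epsilon> * ((x i + x j) / 2))) * R i j = c * R i j - R i j + \<epsilon> * (R i j * ((x i + x j) / 2))"
          by (simp add: algebra_simps)
        moreover have "Re (A i j * G' i j) = c * R i j + \<epsilon> * Re (A i j * (cnj (v i) * v j))"
        proof -
          have "A i j * G' i j = complex_of_real c * (A i j * G i j) + complex_of_real \<epsilon> * (A i j * (cnj (v i) * v j))"
            unfolding G'_def c_def by (simp add: algebra_simps)
          moreover have "Re (complex_of_real b * z) = b * Re z" for b z by simp
          ultimately show ?thesis unfolding R_def by (simp only: plus_complex.sel)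
        qed
        ultimately show "R i j - \<epsilon> * (R i j * ((x i + x j) / 2)) - \<epsilon>\<^sup>2 / 2 * cmod (A i j) + \<epsilon> * Re (A i j * (cnj (v i) * v j)) \<le> Re (A i j * G' i j)"
          unfolding split by linarith
      qed
      finally show ?thesis .
    qed
    ultimately have "\<epsilon> * quad N A v \<le> \<epsilon> * ((\<Sum>i<N. x i * \<mu> i) + \<epsilon> * (1 + C / 2))"
      by (simp add: algebra_simps power2_eq_square)
    then have "quad N A v \<le> (\<Sum>i<N. x i * \<mu> i) + \<epsilon> * (1 + C / 2)" using \<epsilon> by simp
    also have "\<dots> \<le> (\<Sum>i<N. x i * \<mu> i) + \<epsilon> * (1 + C)" using \<epsilon> C by simp
    finally show ?thesis unfolding x_def by (simp add: mult.commute)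
  qed
  define \<eta> where "\<eta> = \<epsilon> * (1 + C)"
  have \<eta>: "0 < \<eta>" using \<epsilon> C by (simp add: \<eta>_def)
  define z where "z = (\<lambda>i. \<mu> i + 2 * \<eta>)"
  show thesis
  proof
    fix i assume i: "i < N"
    define v where "v = (\<lambda>k. if k = i then 1 else 0 :: complex)"
    have "quad N A v = (\<Sum>k<N. \<Sum>j<N. if j = i then (if k = i then Re (A i i) else 0) else 0)"
      unfolding quad_def pairing_def by (intro sum.cong refl) (auto simp: v_def)
    also have "\<dots> = Re (A i i)" using i by simp
    finally have "0 \<le> quad N A v" using diag[OF i] by simp
    also have "\<dots> \<le> (\<Sum>k<N. \<mu> k * (cmod (v k))\<^sup>2) + \<eta>"
      unfolding \<eta>_def by (rule small) (auto simp: v_def)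
    also have "(\<Sum>k<N. \<mu> k * (cmod (v k))\<^sup>2) = (\<Sum>k<N. if k = i then \<mu> i else 0)"
      by (intro sum.cong) (auto simp: v_def)
    also have "\<dots> = \<mu> i" using i by simp
    finally show "0 < z i" using \<eta> by (simp add: z_def)
  next
    have "(\<Sum>i<N. \<mu> i) = pairing N A G" using \<mu>[of "\<lambda>_. 1"] by (simp add: pairing_def R_def)
    then have "(\<Sum>i<N. z i) = pairing N A G + \<epsilon> * (2 * real N * (1 + C))"
      by (simp add: z_def sum.distrib \<eta>_def)
    then show "(\<Sum>i<N. z i) \<le> t + e" using \<epsilon>e bound[OF G] by linarith
  next
    fix v
    show "quad N A v \<le> (\<Sum>i<N. z i * (cmod (v i))\<^sup>2)"
    proof (cases "enorm N v = 0")
      case True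
      then have "v i = 0" if "i < N" for i using that by (simp add: enorm_eq_0)
      then show ?thesis by (simp add: quad_def pairing_def)
    next
      case False
      define b where "b = enorm N v"
      have b: "0 < b" using False enorm_nonneg[of N v] unfolding b_def by linarith
      define w where "w = (\<lambda>i. v i / complex_of_real b)"
      have vw: "v = (\<lambda>i. complex_of_real b * w i)" using b by (auto simp: w_def)
      have "cmod (w i) \<le> 1" if "i < N" for i
        using norm_le_enorm[OF that, of v] b by (simp add: w_def norm_divide b_def[symmetric])
      then have "quad N A w \<le> (\<Sum>i<N. \<mu> i * (cmod (w i))\<^sup>2) + \<eta> * 1"
        unfolding \<eta>_def using small by simp
      also have "1 = (\<Sum>i<N. (cmod (w i))\<^sup>2)"
        using b by (simp add: w_def norm_divide power_divide sum_divide_distrib[symmetric]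
          enorm_sq[symmetric] b_def[symmetric])
      also have "(\<Sum>i<N. \<mu> i * (cmod (w i))\<^sup>2) + \<eta> * (\<Sum>i<N. (cmod (w i))\<^sup>2) = (\<Sum>i<N. (\<mu> i + \<eta>) * (cmod (w i))\<^sup>2)"
        by (simp add: sum_distrib_left sum.distrib algebra_simps)
      also have "\<dots> \<le> (\<Sum>i<N. z i * (cmod (w i))\<^sup>2)"
        using \<eta> by (intro sum_mono mult_right_mono) (auto simp: z_def)
      finally have "b\<^sup>2 * quad N A w \<le> b\<^sup>2 * (\<Sum>i<N. z i * (cmod (w i))\<^sup>2)"
        by (intro mult_left_mono) auto
      also have "\<dots> = (\<Sum>i<N. z i * (cmod (v i))\<^sup>2)"
        unfolding vw sum_distrib_left by (intro sum.cong) (auto simp: norm_mult power_mult_distrib)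
      finally show ?thesis unfolding vw quad_scale by simp
    qed
  qed
qed

section \<open>The completely bounded norm as a supremum over correlation matrices\<close>

text \<open>The matrix \<open>X\<^sup>* X\<close> for a matrix \<open>X\<close> with \<open>m\<close> rows.\<close>
definition gram :: "nat \<Rightarrow> (nat \<Rightarrow> nat \<Rightarrow> complex) \<Rightarrow> nat \<Rightarrow> nat \<Rightarrow> complex" where
  "gram m X i j = (\<Sum>l<m. cnj (X l i) * X l j)"

lemma pairing_gram_rank_one:
  "pairing n (gram m X) (\<lambda>i j. a i * b j) =
     Re (\<Sum>l<m. cnj (mulv n X (\<lambda>i. cnj (a i)) l) * mulv n X b l)"
proof -
  have "pairing n (gram m X) (\<lambda>i j. a i * b j) =
     Re (\<Sum>i<n. \<Sum>j<n. \<Sum>l<m. (cnj (X l i) * a i) * (X l j * b j))"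
    unfolding pairing_def gram_def Re_sum sum_distrib_right
    by (intro sum.cong refl arg_cong[where f = Re]) (simp add: algebra_simps)
  also have "(\<Sum>i<n. \<Sum>j<n. \<Sum>l<m. (cnj (X l i) * a i) * (X l j * b j)) =
     (\<Sum>l<m. \<Sum>i<n. \<Sum>j<n. (cnj (X l i) * a i) * (X l j * b j))"
    by (subst (2) sum.swap, subst sum.swap, rule refl)
  also have "\<dots> = (\<Sum>l<m. cnj (mulv n X (\<lambda>i. cnj (a i)) l) * mulv n X b l)"
    by (intro sum.cong refl) (simp add: mulv_def sum_product)
  finally show ?thesis .
qed

lemma quad_gram: "quad n (gram m X) v = (enorm m (mulv n X v))\<^sup>2"
proof -
  show ?thesis
    unfolding quad_def pairing_gram_rank_one enorm_sq Re_sum by (simp add: Re_cnj_mult_self del: times_complex.sel)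
qed

lemma gram_diag_nonneg: "0 \<le> Re (gram m X i i)"
  unfolding gram_def Re_sum by (intro sum_nonneg) simp

lemma pairing_gram_le:
  assumes X: "X \<in> carrier_mat m n"
    and a: "\<And>i. i < n \<Longrightarrow> cmod (a i) \<le> \<alpha>" "0 \<le> \<alpha>"
    and b: "\<And>i. i < n \<Longrightarrow> cmod (b i) \<le> \<beta>" "0 \<le> \<beta>"
  shows "pairing n (gram m (entry X)) (\<lambda>i j. a i * b j) \<le> \<alpha> * \<beta> * (F_norm X)\<^sup>2"
proof -
  let ?u = "mulv n (entry X) (\<lambda>i. cnj (a i))" and ?w = "mulv n (entry X) b"
  have "pairing n (gram m (entry X)) (\<lambda>i j. a i * b j) \<le> cmod (\<Sum>l<m. cnj (?u l) * ?w l)"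
    unfolding pairing_gram_rank_one by (rule complex_Re_le_cmod)
  also have "\<dots> \<le> enorm m ?u * enorm m ?w"
    using enorm_cauchy_schwarz[of "\<lambda>l. cnj (?u l)" ?w m] by simp
  also have "\<dots> \<le> (\<alpha> * F_norm X) * (\<beta> * F_norm X)"
    using a b F_norm_nonneg[OF X] by (intro mult_mono F_norm_upper[OF X]) auto
  finally show ?thesis by (simp add: power2_eq_square algebra_simps)
qed

lemma cbF_set_nonempty:
  assumes X: "X \<in> carrier_mat m n" and n: "0 < n"
  shows "{op_norm B | B (\<xi> :: nat \<Rightarrow> real). B \<in> carrier_mat (dim_row X) (dim_col X) \<and>
     (\<forall>j<dim_col X. 0 \<le> \<xi> j) \<and> L2_set \<xi> {..<dim_col X} = 1 \<and>
     X = B * mat_diag (dim_col X) (\<lambda>j. complex_of_real (\<xi> j))} \<noteq> {}"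
proof -
  define x where "x = 1 / sqrt (real n)"
  have x: "0 < x" using n by (simp add: x_def)
  define B where "B = mat m n (\<lambda>(i, j). entry X i j / complex_of_real x)"
  have B: "B \<in> carrier_mat m n" by (simp add: B_def)
  have "X = B * mat_diag n (\<lambda>j. complex_of_real x)"
    unfolding mat_diag_mult_right[OF B] using X x by (intro eq_matI) (auto simp: B_def)
  moreover have "L2_set (\<lambda>j. x) {..<n} = 1" using n by (simp add: L2_set_constant x_def)
  ultimately have P: "B \<in> carrier_mat (dim_row X) (dim_col X) \<and> (\<forall>j<dim_col X. 0 \<le> x) \<and>
     L2_set (\<lambda>j. x) {..<dim_col X} = 1 \<and> X = B * mat_diag (dim_col X) (\<lambda>j. complex_of_real x)"
    unfolding carrier_matD[OF X] using B x by (intro conjI) auto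
  show ?thesis
    unfolding ex_in_conv[symmetric] mem_Collect_eq
    by (intro exI[of _ "op_norm B"] exI[of _ B] exI[of _ "\<lambda>j. x"]) (rule conjI[OF refl P])
qed

lemma cbF_norm_nonneg:
  assumes X: "X \<in> carrier_mat m n" and n: "0 < n"
  shows "0 \<le> cbF_norm X"
  unfolding cbF_norm_def using op_norm_nonneg
  by (intro cInf_greatest cbF_set_nonempty[OF X n]) blast

lemma cbF_norm_lower:
  assumes X: "X \<in> carrier_mat m n" and B: "B \<in> carrier_mat m n"
    and \<xi>: "\<And>j. j < n \<Longrightarrow> 0 \<le> \<xi> j" "L2_set \<xi> {..<n} = 1"
    and XB: "X = B * mat_diag n (\<lambda>j. complex_of_real (\<xi> j))"
  shows "cbF_norm X \<le> op_norm B"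
  unfolding cbF_norm_def
proof (rule cInf_lower)
  show "bdd_below {op_norm B | B (\<xi> :: nat \<Rightarrow> real). B \<in> carrier_mat (dim_row X) (dim_col X) \<and>
     (\<forall>j<dim_col X. 0 \<le> \<xi> j) \<and> L2_set \<xi> {..<dim_col X} = 1 \<and>
     X = B * mat_diag (dim_col X) (\<lambda>j. complex_of_real (\<xi> j))}"
    using op_norm_nonneg by (intro bdd_belowI[of _ 0]) blast
  show "op_norm B \<in> {op_norm B | B (\<xi> :: nat \<Rightarrow> real). B \<in> carrier_mat (dim_row X) (dim_col X) \<and>
     (\<forall>j<dim_col X. 0 \<le> \<xi> j) \<and> L2_set \<xi> {..<dim_col X} = 1 \<and>
     X = B * mat_diag (dim_col X) (\<lambda>j. complex_of_real (\<xi> j))}"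
    unfolding carrier_matD[OF X] mem_Collect_eq
    by (intro exI[of _ B] exI[of _ \<xi>] conjI refl B \<xi>(2) XB allI impI \<xi>(1))
qed

text \<open>
  A majorant \<open>z\<close> of \<open>X\<^sup>* X\<close> of total mass \<open>s\<close> gives the factorisation of \<open>X\<close> with
  \<open>\<xi> j = sqrt (z j / s)\<close>.
\<close>
lemma cbF_norm_le_sqrt:
  assumes X: "X \<in> carrier_mat m n" and n: "0 < n"
    and t: "\<And>G. correlation n G \<Longrightarrow> pairing n (gram m (entry X)) G \<le> t"
  shows "cbF_norm X \<le> sqrt t"
proof -
  have "(cbF_norm X)\<^sup>2 \<le> t + e" if e: "0 < e" for e
  proof -
    obtain z where z: "\<And>i. i < n \<Longrightarrow> 0 < z i" "(\<Sum>i<n. z i) \<le> t + e"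
      "\<And>v. quad n (gram m (entry X)) v \<le> (\<Sum>i<n. z i * (cmod (v i))\<^sup>2)"
      using diagonal_majorant[of n "gram m (entry X)", OF gram_diag_nonneg t e] by blast
    define s where "s = (\<Sum>i<n. z i)"
    have s: "0 < s" unfolding s_def using z n by (intro sum_pos) auto
    define \<xi> where "\<xi> = (\<lambda>j. sqrt (z j / s))"
    have \<xi>: "0 < \<xi> j" "(\<xi> j)\<^sup>2 = z j / s" if "j < n" for j
      using z(1)[OF that] s by (auto simp: \<xi>_def)
    have "(\<Sum>j<n. (\<xi> j)\<^sup>2) = (\<Sum>j<n. z j / s)" using \<xi> by (intro sum.cong) auto
    also have "\<dots> = 1" using s by (simp add: s_def sum_divide_distrib[symmetric])
    finally have \<xi>1: "L2_set \<xi> {..<n} = 1" by (simp add: L2_set_def)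
    define B where "B = mat m n (\<lambda>(i, j). entry X i j / complex_of_real (\<xi> j))"
    have B: "B \<in> carrier_mat m n" by (simp add: B_def)
    have "X = B * mat_diag n (\<lambda>j. complex_of_real (\<xi> j))"
      unfolding mat_diag_mult_right[OF B] using X \<xi>(1)
      by (intro eq_matI) (auto simp: B_def less_le)
    then have "cbF_norm X \<le> op_norm B"
      using \<xi> \<xi>1 B by (intro cbF_norm_lower[OF X]) (auto simp: less_imp_le)
    also have "\<dots> \<le> sqrt s"
    proof (rule op_norm_least[OF B])
      fix v
      define w where "w = (\<lambda>j. v j / complex_of_real (\<xi> j))"
      have "(enorm m (mulv n (entry B) v))\<^sup>2 = (enorm m (mulv n (entry X) w))\<^sup>2"
        by (intro arg_cong[where f = "\<lambda>x. x\<^sup>2"] enorm_cong) (auto simp: mulv_def B_def w_def intro!: sum.cong)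
      also have "\<dots> \<le> (\<Sum>i<n. z i * (cmod (w i))\<^sup>2)"
        using z(3) by (simp add: quad_gram)
      also have "\<dots> = (\<Sum>i<n. s * (cmod (v i))\<^sup>2)"
      proof (intro sum.cong refl)
        fix i assume "i \<in> {..<n}"
        then have "0 < \<xi> i" "z i = s * (\<xi> i)\<^sup>2" using \<xi>[of i] s by auto
        then show "z i * (cmod (w i))\<^sup>2 = s * (cmod (v i))\<^sup>2"
          by (simp add: w_def norm_divide power_divide)
      qed
      also have "\<dots> = (sqrt s * enorm n v)\<^sup>2"
        using s by (simp add: power_mult_distrib enorm_sq sum_distrib_left)
      finally show "enorm m (mulv n (entry B) v) \<le> sqrt s * enorm n v"
        by (rule power2_le_imp_le) (use s in simp)
    qed (use s in simp)
    finally have "(cbF_norm X)\<^sup>2 \<le> (sqrt s)\<^sup>2"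
      using cbF_norm_nonneg[OF X n] by (intro power_mono)
    then show ?thesis using s z(2) by (simp add: s_def)
  qed
  then have "(cbF_norm X)\<^sup>2 \<le> t" by (rule field_le_epsilon)
  then show ?thesis by (rule real_le_rsqrt)
qed

text \<open>The converse estimate: every factorisation of \<open>X\<close> bounds the pairings of \<open>X\<^sup>* X\<close>.\<close>
lemma pairing_gram_le_cbF_norm:
  assumes X: "X \<in> carrier_mat m n" and n: "0 < n" and G: "correlation n G"
  shows "pairing n (gram m (entry X)) G \<le> (cbF_norm X)\<^sup>2"
proof -
  obtain r and V :: "nat \<Rightarrow> nat \<Rightarrow> complex" where V: "\<forall>i<n. (\<Sum>k<r. (cmod (V k i))\<^sup>2) = 1"
    and G: "\<forall>i<n. \<forall>j<n. G i j = (\<Sum>k<r. cnj (V k i) * V k j)"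
    using G unfolding correlation_def by blast
  have "sqrt (pairing n (gram m (entry X)) G) \<le> cbF_norm X + e" if e: "0 < e" for e
  proof -
    have "Inf {op_norm B | B (\<xi> :: nat \<Rightarrow> real). B \<in> carrier_mat (dim_row X) (dim_col X) \<and>
     (\<forall>j<dim_col X. 0 \<le> \<xi> j) \<and> L2_set \<xi> {..<dim_col X} = 1 \<and>
     X = B * mat_diag (dim_col X) (\<lambda>j. complex_of_real (\<xi> j))} < cbF_norm X + e"
      using e by (simp add: cbF_norm_def)
    from cInf_lessD[OF cbF_set_nonempty[OF X n] this]
    obtain B and \<xi> :: "nat \<Rightarrow> real" where B: "B \<in> carrier_mat m n" and Be: "op_norm B < cbF_norm X + e"
      and \<xi>: "\<forall>j<n. 0 \<le> \<xi> j" "L2_set \<xi> {..<n} = 1" and XB: "X = B * mat_diag n (\<lambda>j. complex_of_real (\<xi> j))"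
      unfolding carrier_matD[OF X] by blast
    have \<xi>1: "(\<Sum>j<n. (\<xi> j)\<^sup>2) = 1" using \<xi>(2) by (simp add: L2_set_def)
    have Xij: "entry X i j = entry B i j * complex_of_real (\<xi> j)" if "i < m" "j < n" for i j
      unfolding XB mat_diag_mult_right[OF B] using that by simp
    have "pairing n (gram m (entry X)) G = (\<Sum>k<r. (enorm m (mulv n (entry X) (V k)))\<^sup>2)"
      using G by (subst pairing_gram[where r = r and V = V]) (auto simp: quad_gram)
    also have "\<dots> \<le> (\<Sum>k<r. (op_norm B)\<^sup>2 * (\<Sum>j<n. (\<xi> j)\<^sup>2 * (cmod (V k j))\<^sup>2))"
    proof (rule sum_mono)
      fix k
      have "enorm m (mulv n (entry X) (V k)) = enorm m (mulv n (entry B) (\<lambda>j. complex_of_real (\<xi> j) * V k j))"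
        by (intro enorm_cong) (auto simp: mulv_def Xij algebra_simps intro!: sum.cong)
      also have "\<dots> \<le> op_norm B * enorm n (\<lambda>j. complex_of_real (\<xi> j) * V k j)"
        by (rule op_norm_upper[OF B])
      finally have "(enorm m (mulv n (entry X) (V k)))\<^sup>2 \<le> (op_norm B * enorm n (\<lambda>j. complex_of_real (\<xi> j) * V k j))\<^sup>2"
        by (intro power_mono) auto
      then show "(enorm m (mulv n (entry X) (V k)))\<^sup>2 \<le> (op_norm B)\<^sup>2 * (\<Sum>j<n. (\<xi> j)\<^sup>2 * (cmod (V k j))\<^sup>2)"
        by (simp add: power_mult_distrib enorm_sq norm_mult)
    qed
    also have "\<dots> = (op_norm B)\<^sup>2 * (\<Sum>j<n. (\<xi> j)\<^sup>2 * (\<Sum>k<r. (cmod (V k j))\<^sup>2))"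
      unfolding sum_distrib_left by (subst sum.swap) (simp add: algebra_simps)
    also have "(\<Sum>j<n. (\<xi> j)\<^sup>2 * (\<Sum>k<r. (cmod (V k j))\<^sup>2)) = (\<Sum>j<n. (\<xi> j)\<^sup>2)"
      using V by (intro sum.cong) auto
    finally have "pairing n (gram m (entry X)) G \<le> (op_norm B)\<^sup>2" using \<xi>1 by simp
    then have "sqrt (pairing n (gram m (entry X)) G) \<le> op_norm B"
      using op_norm_nonneg[OF B] by (intro real_le_lsqrt) auto
    then show ?thesis using Be by simp
  qed
  then have "sqrt (pairing n (gram m (entry X)) G) \<le> cbF_norm X" by (rule field_le_epsilon)
  then show ?thesis by (rule sqrt_le_D)
qed

section \<open>The Schur multiplier norm\<close>

lemma schur_product_carrier: "X \<in> carrier_mat m n \<Longrightarrow> schur_product X A \<in> carrier_mat m n"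
  by (auto simp: schur_product_def)

lemma entry_schur_product: "X \<in> carrier_mat m n \<Longrightarrow> i < m \<Longrightarrow> j < n \<Longrightarrow>
  entry (schur_product X A) i j = entry X i j * entry A i j"
  by (auto simp: schur_product_def)

lemma op_norm_zero_mat_le: "op_norm (0\<^sub>m m n) \<le> 1"
proof (rule op_norm_least)
  fix v show "enorm m (mulv n (entry (0\<^sub>m m n)) v) \<le> 1 * enorm n v"
  proof -
    have "enorm m (mulv n (entry (0\<^sub>m m n)) v) = 0" by (auto simp: enorm_eq_0 mulv_def)
    then show ?thesis by simp
  qed
qed auto

lemma schur_norm_upper:
  assumes X: "X \<in> carrier_mat m n" and A: "A \<in> carrier_mat m n" and A1: "op_norm A \<le> 1"
  shows "op_norm (schur_product X A) \<le> schur_norm X"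
  unfolding schur_norm_def
proof (rule cSup_upper)
  show "bdd_above {op_norm (schur_product X A) |A. A \<in> carrier_mat (dim_row X) (dim_col X) \<and> op_norm A \<le> 1}"
  proof (rule bdd_aboveI)
    fix x assume "x \<in> {op_norm (schur_product X A) |A. A \<in> carrier_mat (dim_row X) (dim_col X) \<and> op_norm A \<le> 1}"
    then obtain A where x: "x = op_norm (schur_product X A)" and A: "A \<in> carrier_mat m n" "op_norm A \<le> 1"
      using X by auto
    show "x \<le> (\<Sum>i<m. \<Sum>j<n. cmod (entry X i j))"
      unfolding x
    proof (rule op_norm_least[OF schur_product_carrier[OF X]])
      fix v
      have "cmod (entry A i j * v j) \<le> enorm n v" if "i < m" "j < n" for i j
      proof -
        have "cmod (entry A i j) * cmod (v j) \<le> 1 * enorm n v"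
          using norm_entry_le_op_norm[OF A(1) that] A(2) norm_le_enorm[OF that(2), of v] by (intro mult_mono) auto
        then show ?thesis by (simp add: norm_mult)
      qed
      note bd = this
      have "enorm m (mulv n (entry (schur_product X A)) v) \<le> (\<Sum>i<m. \<bar>cmod (mulv n (entry (schur_product X A)) v i)\<bar>)"
        unfolding enorm_def by (rule L2_set_le_sum_abs)
      also have "\<dots> \<le> (\<Sum>i<m. \<Sum>j<n. cmod (entry X i j) * enorm n v)"
        unfolding mulv_def abs_norm_cancel
      proof (intro sum_mono sum_norm_le)
        fix i j assume "i \<in> {..<m}" "j \<in> {..<n}"
        then have ij: "i < m" "j < n" by auto
        have "cmod (entry (schur_product X A) i j * v j) = cmod (entry X i j) * cmod (entry A i j * v j)"
          unfolding entry_schur_product[OF X ij] by (simp add: norm_mult)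
        then show "cmod (entry (schur_product X A) i j * v j) \<le> cmod (entry X i j) * enorm n v"
          using bd[OF ij] by (simp add: mult_left_mono)
      qed
      finally show "enorm m (mulv n (entry (schur_product X A)) v) \<le> (\<Sum>i<m. \<Sum>j<n. cmod (entry X i j)) * enorm n v"
        by (simp add: sum_distrib_right)
    qed (auto intro!: sum_nonneg)
  qed
  show "op_norm (schur_product X A) \<in> {op_norm (schur_product X A) |A. A \<in> carrier_mat (dim_row X) (dim_col X) \<and> op_norm A \<le> 1}"
    using X A A1 by auto
qed

lemma schur_norm_nonneg:
  assumes X: "X \<in> carrier_mat m n"
  shows "0 \<le> schur_norm X"
  using schur_norm_upper[OF X zero_carrier_mat op_norm_zero_mat_le]
    op_norm_nonneg[OF schur_product_carrier[OF X, of "0\<^sub>m m n"]] by linarith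

text \<open>
  If \<open>G i j = \<langle>V i, V j\<rangle>\<close> with unit vectors, then row \<open>i\<close> of \<open>(G \<circ> A) w\<close> is the inner product of \<open>V i\<close>
  with the vector of all \<open>(A (V k w)) i\<close>, where \<open>V k w\<close> is the entrywise product; Cauchy--Schwarz gives
  the bound 1.
\<close>
lemma schur_norm_correlation_le:
  assumes G: "correlation n G"
  shows "schur_norm (mat n n (\<lambda>(i, j). G i j)) \<le> 1"
proof -
  obtain r and V :: "nat \<Rightarrow> nat \<Rightarrow> complex" where V: "\<forall>i<n. (\<Sum>k<r. (cmod (V k i))\<^sup>2) = 1"
    and G: "\<forall>i<n. \<forall>j<n. G i j = (\<Sum>k<r. cnj (V k i) * V k j)"
    using G unfolding correlation_def by blast
  let ?X = "mat n n (\<lambda>(i, j). G i j)"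
  have X: "?X \<in> carrier_mat n n" by simp
  have "op_norm (schur_product ?X A) \<le> 1" if A: "A \<in> carrier_mat n n" and A1: "op_norm A \<le> 1" for A
  proof (rule op_norm_least[OF schur_product_carrier[OF X]])
    fix w
    define u where "u = (\<lambda>k. mulv n (entry A) (\<lambda>j. V k j * w j))"
    have row: "(cmod (mulv n (entry (schur_product ?X A)) w i))\<^sup>2 \<le> (\<Sum>k<r. (cmod (u k i))\<^sup>2)" if i: "i < n" for i
    proof -
      have "mulv n (entry (schur_product ?X A)) w i = (\<Sum>j<n. (\<Sum>k<r. cnj (V k i) * V k j) * entry A i j * w j)"
        unfolding mulv_def using G i by (intro sum.cong refl) (simp add: entry_schur_product[OF X])
      also have "\<dots> = (\<Sum>k<r. cnj (V k i) * u k i)"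
        unfolding u_def mulv_def sum_distrib_left sum_distrib_right
        by (subst sum.swap) (simp add: algebra_simps)
      finally have "cmod (mulv n (entry (schur_product ?X A)) w i) \<le> enorm r (\<lambda>k. cnj (V k i)) * enorm r (\<lambda>k. u k i)"
        using enorm_cauchy_schwarz[of "\<lambda>k. cnj (V k i)" "\<lambda>k. u k i" r] by simp
      also have "enorm r (\<lambda>k. cnj (V k i)) = 1"
        using V i by (simp add: enorm_def L2_set_def)
      finally have "(cmod (mulv n (entry (schur_product ?X A)) w i))\<^sup>2 \<le> (enorm r (\<lambda>k. u k i))\<^sup>2"
        by (intro power_mono) auto
      then show ?thesis by (simp add: enorm_sq)
    qed
    have "(enorm n (mulv n (entry (schur_product ?X A)) w))\<^sup>2 \<le> (\<Sum>i<n. \<Sum>k<r. (cmod (u k i))\<^sup>2)"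
      unfolding enorm_sq by (intro sum_mono row) auto
    also have "\<dots> = (\<Sum>k<r. (enorm n (u k))\<^sup>2)" unfolding enorm_sq by (rule sum.swap)
    also have "\<dots> \<le> (\<Sum>k<r. (enorm n (\<lambda>j. V k j * w j))\<^sup>2)"
    proof (intro sum_mono power_mono)
      fix k
      have "enorm n (u k) \<le> op_norm A * enorm n (\<lambda>j. V k j * w j)"
        unfolding u_def by (rule op_norm_upper[OF A])
      also have "\<dots> \<le> 1 * enorm n (\<lambda>j. V k j * w j)" using A1 by (intro mult_right_mono) auto
      finally show "enorm n (u k) \<le> enorm n (\<lambda>j. V k j * w j)" by simp
    qed auto
    also have "\<dots> = (\<Sum>j<n. (\<Sum>k<r. (cmod (V k j))\<^sup>2) * (cmod (w j))\<^sup>2)"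
      unfolding enorm_sq sum_distrib_right by (subst sum.swap) (simp add: norm_mult power_mult_distrib)
    also have "\<dots> = (enorm n w)\<^sup>2" unfolding enorm_sq using V by (intro sum.cong) auto
    finally show "enorm n (mulv n (entry (schur_product ?X A)) w) \<le> 1 * enorm n w"
      unfolding mult_1 by (rule power2_le_imp_le) simp
  qed simp
  note le = this
  show ?thesis
    unfolding schur_norm_def carrier_matD[OF X]
  proof (rule cSup_least)
    show "{op_norm (schur_product ?X A) |A. A \<in> carrier_mat n n \<and> op_norm A \<le> 1} \<noteq> {}"
      using op_norm_zero_mat_le[of n n] zero_carrier_mat[of n n] by blast
  qed (use le in blast)
qed

section \<open>The projective norm\<close>

text \<open>
  The matrix \<open>Z\<close> is a sum of elementary tensors \<open>a\<^sub>k \<otimes> b\<^sub>k\<close> whose products of max norms add up to at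
  most \<open>c\<close>. For \<open>c\<close> other than the
  projective norm this means that the projective norm of \<open>Z\<close> is at most \<open>c\<close>; working with the
  predicate avoids infima.
\<close>
definition proj_bound :: "nat \<Rightarrow> nat \<Rightarrow> (nat \<Rightarrow> nat \<Rightarrow> complex) \<Rightarrow> real \<Rightarrow> bool" where
  "proj_bound m n Z c \<longleftrightarrow> (\<exists>r (a :: nat \<Rightarrow> complex vec) (b :: nat \<Rightarrow> complex vec).
     (\<forall>k<r. a k \<in> carrier_vec m \<and> b k \<in> carrier_vec n) \<and>
     (\<forall>i<m. \<forall>j<n. Z i j = (\<Sum>k<r. a k $ i * b k $ j)) \<and>
     (\<Sum>k<r. max_norm (a k) * max_norm (b k)) \<le> c)"

lemma proj_boundE:
  assumes "proj_bound m n Z c"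
  obtains r :: nat and a b :: "nat \<Rightarrow> complex vec"
  where "\<And>k. k < r \<Longrightarrow> a k \<in> carrier_vec m" "\<And>k. k < r \<Longrightarrow> b k \<in> carrier_vec n"
    "\<And>i j. i < m \<Longrightarrow> j < n \<Longrightarrow> Z i j = (\<Sum>k<r. a k $ i * b k $ j)"
    "(\<Sum>k<r. max_norm (a k) * max_norm (b k)) \<le> c"
  using assms unfolding proj_bound_def by blast

lemma proj_bound_cong:
  assumes "proj_bound m n Z c" and Z: "\<And>i j. i < m \<Longrightarrow> j < n \<Longrightarrow> Z i j = Z' i j" and c: "c \<le> c'"
  shows "proj_bound m n Z' c'"
proof -
  obtain r :: nat and a b :: "nat \<Rightarrow> complex vec" where
    "\<forall>k<r. a k \<in> carrier_vec m \<and> b k \<in> carrier_vec n"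
    "\<forall>i<m. \<forall>j<n. Z i j = (\<Sum>k<r. a k $ i * b k $ j)"
    "(\<Sum>k<r. max_norm (a k) * max_norm (b k)) \<le> c"
    using assms(1) unfolding proj_bound_def by blast
  then show ?thesis
    unfolding proj_bound_def using Z c by (intro exI[of _ r] exI[of _ a] exI[of _ b]) auto
qed

lemma proj_bound_rank_one:
  assumes "\<And>i. i < m \<Longrightarrow> cmod (a i) \<le> \<alpha>" "\<And>j. j < n \<Longrightarrow> cmod (b j) \<le> \<beta>" "0 \<le> \<alpha>" "0 \<le> \<beta>"
  shows "proj_bound m n (\<lambda>i j. a i * b j) (\<alpha> * \<beta>)"
proof -
  have "max_norm (vec m a) * max_norm (vec n b) \<le> \<alpha> * \<beta>"
    using assms by (intro mult_mono max_norm_nonneg) (auto simp: max_norm_le_iff)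
  then show ?thesis
    unfolding proj_bound_def
    by (intro exI[of _ 1] exI[of _ "\<lambda>_. vec m a"] exI[of _ "\<lambda>_. vec n b"]) auto
qed

lemma proj_bound_zero: "proj_bound m n (\<lambda>i j. 0) 0"
  unfolding proj_bound_def by (intro exI[of _ 0]) auto

lemma sum_lessThan_add: "(\<Sum>k<p + q. f k) = (\<Sum>k<p. f k) + (\<Sum>k<q. f (p + k))" for f :: "nat \<Rightarrow> 'a::comm_monoid_add"
  by (induction q) (auto simp: add.assoc)

lemma proj_bound_add:
  assumes "proj_bound m n Z c" "proj_bound m n Z' c'"
  shows "proj_bound m n (\<lambda>i j. Z i j + Z' i j) (c + c')"
proof -
  obtain r :: nat and a b where 1: "\<And>k. k < r \<Longrightarrow> a k \<in> carrier_vec m" "\<And>k. k < r \<Longrightarrow> b k \<in> carrier_vec n"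
     "\<And>i j. i < m \<Longrightarrow> j < n \<Longrightarrow> Z i j = (\<Sum>k<r. a k $ i * b k $ j)"
     "(\<Sum>k<r. max_norm (a k) * max_norm (b k)) \<le> c"
    using assms(1) by (rule proj_boundE) blast
  obtain r' :: nat and a' b' where 2: "\<And>k. k < r' \<Longrightarrow> a' k \<in> carrier_vec m" "\<And>k. k < r' \<Longrightarrow> b' k \<in> carrier_vec n"
     "\<And>i j. i < m \<Longrightarrow> j < n \<Longrightarrow> Z' i j = (\<Sum>k<r'. a' k $ i * b' k $ j)"
     "(\<Sum>k<r'. max_norm (a' k) * max_norm (b' k)) \<le> c'"
    using assms(2) by (rule proj_boundE) blast
  define A where "A = (\<lambda>k. if k < r then a k else a' (k - r))"
  define B where "B = (\<lambda>k. if k < r then b k else b' (k - r))"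
  have "A k \<in> carrier_vec m \<and> B k \<in> carrier_vec n" if "k < r + r'" for k
  proof -
    have "k < r \<or> k - r < r'" using that by auto
    then show ?thesis using 1 2 by (auto simp: A_def B_def)
  qed
  moreover have "Z i j + Z' i j = (\<Sum>k<r + r'. A k $ i * B k $ j)" if "i < m" "j < n" for i j
    unfolding sum_lessThan_add using 1(3)[OF that] 2(3)[OF that] by (simp add: A_def B_def)
  moreover have "(\<Sum>k<r + r'. max_norm (A k) * max_norm (B k)) \<le> c + c'"
    unfolding sum_lessThan_add using 1(4) 2(4) by (simp add: A_def B_def)
  ultimately show ?thesis
    unfolding proj_bound_def by blast
qed

lemma proj_bound_sum:
  assumes "finite I" "\<And>p. p \<in> I \<Longrightarrow> proj_bound m n (Z p) (c p)"
  shows "proj_bound m n (\<lambda>i j. \<Sum>p\<in>I. Z p i j) (\<Sum>p\<in>I. c p)"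
  using assms by (induction I rule: finite_induct) (auto intro: proj_bound_zero proj_bound_add)

lemma proj_bound_scale:
  assumes "proj_bound m n Z c" "0 \<le> t"
  shows "proj_bound m n (\<lambda>i j. complex_of_real t * Z i j) (t * c)"
proof -
  obtain r :: nat and a b where 1: "\<And>k. k < r \<Longrightarrow> a k \<in> carrier_vec m" "\<And>k. k < r \<Longrightarrow> b k \<in> carrier_vec n"
     "\<And>i j. i < m \<Longrightarrow> j < n \<Longrightarrow> Z i j = (\<Sum>k<r. a k $ i * b k $ j)"
     "(\<Sum>k<r. max_norm (a k) * max_norm (b k)) \<le> c"
    using assms(1) by (rule proj_boundE) blast
  have "proj_bound m n (\<lambda>i j. \<Sum>k<r. (complex_of_real t * a k $ i) * b k $ j) (\<Sum>k<r. (t * max_norm (a k)) * max_norm (b k))"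
    using assms(2) carrier_vecD[OF 1(1)] carrier_vecD[OF 1(2)] max_norm_nonneg
    by (intro proj_bound_sum proj_bound_rank_one) (auto simp: norm_mult intro!: mult_left_mono norm_le_max_norm)
  then show ?thesis
  proof (rule proj_bound_cong)
    show "(\<Sum>k<r. (t * max_norm (a k)) * max_norm (b k)) \<le> t * c"
      using 1(4) assms(2) by (simp add: mult.assoc sum_distrib_left[symmetric] mult_left_mono)
  qed (use 1(3) in \<open>simp add: mult.assoc sum_distrib_left\<close>)
qed

lemma proj_bound_sum_entries: "proj_bound m n Z (\<Sum>i<m. \<Sum>j<n. cmod (Z i j))"
proof -
  have "proj_bound m n (\<lambda>i j. \<Sum>p<m. \<Sum>q<n. (if i = p then 1 else 0) * (if j = q then Z p q else 0))
     (\<Sum>p<m. \<Sum>q<n. 1 * cmod (Z p q))"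
    by (intro proj_bound_sum proj_bound_rank_one) auto
  then show ?thesis
  proof (rule proj_bound_cong)
    fix i j assume "i < m" "j < n"
    have "(\<Sum>p<m. \<Sum>q<n. (if i = p then 1 else 0) * (if j = q then Z p q else 0)) =
      (\<Sum>p<m. \<Sum>q<n. if q = j then (if p = i then Z i j else 0) else 0)"
      by (intro sum.cong refl) auto
    then show "(\<Sum>p<m. \<Sum>q<n. (if i = p then 1 else 0) * (if j = q then Z p q else 0)) = Z i j"
      using \<open>i < m\<close> \<open>j < n\<close> by simp
  qed simp
qed

lemma norm_le_proj_bound:
  assumes "proj_bound m n Z c" "i < m" "j < n"
  shows "cmod (Z i j) \<le> c"
proof -
  obtain r :: nat and a b where 1: "\<And>k. k < r \<Longrightarrow> a k \<in> carrier_vec m" "\<And>k. k < r \<Longrightarrow> b k \<in> carrier_vec n"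
     "\<And>i j. i < m \<Longrightarrow> j < n \<Longrightarrow> Z i j = (\<Sum>k<r. a k $ i * b k $ j)"
     "(\<Sum>k<r. max_norm (a k) * max_norm (b k)) \<le> c"
    using assms(1) by (rule proj_boundE) blast
  have "cmod (\<Sum>k<r. a k $ i * b k $ j) \<le> (\<Sum>k<r. max_norm (a k) * max_norm (b k))"
  proof (rule sum_norm_le)
    fix k assume "k \<in> {..<r}"
    then have "dim_vec (a k) = m" "dim_vec (b k) = n" using 1(1)[of k] 1(2)[of k] by auto
    then show "cmod (a k $ i * b k $ j) \<le> max_norm (a k) * max_norm (b k)"
      unfolding norm_mult using assms(2,3) by (intro mult_mono norm_le_max_norm max_norm_nonneg) auto
  qed
  then show ?thesis using 1(3)[OF assms(2,3)] 1(4) by simp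
qed

lemma projective_norm_le: 
  assumes X: "X \<in> carrier_mat m n" and "proj_bound m n (entry X) c"
  shows "projective_norm X \<le> c"
proof -
  obtain r :: nat and a b where 1: "\<And>k. k < r \<Longrightarrow> a k \<in> carrier_vec m" "\<And>k. k < r \<Longrightarrow> b k \<in> carrier_vec n"
     "\<And>i j. i < m \<Longrightarrow> j < n \<Longrightarrow> entry X i j = (\<Sum>k<r. a k $ i * b k $ j)"
     "(\<Sum>k<r. max_norm (a k) * max_norm (b k)) \<le> c"
    using assms(2) by (rule proj_boundE) blast
  have "projective_norm X \<le> (\<Sum>k<r. max_norm (a k) * max_norm (b k))"
    unfolding projective_norm_def carrier_matD[OF X]
  proof (rule cInf_lower)
    show "(\<Sum>k<r. max_norm (a k) * max_norm (b k)) \<in> {\<Sum>k<r. max_norm (a k) * max_norm (b k) |(r :: nat) a b.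
        (\<forall>k<r. a k \<in> carrier_vec m \<and> b k \<in> carrier_vec n) \<and>
        (\<forall>i<m. \<forall>j<n. entry X i j = (\<Sum>k<r. a k $ i * b k $ j))}"
      using 1 by blast
    show "bdd_below {\<Sum>k<r. max_norm (a k) * max_norm (b k) |(r :: nat) a b.
        (\<forall>k<r. a k \<in> carrier_vec m \<and> b k \<in> carrier_vec n) \<and>
        (\<forall>i<m. \<forall>j<n. entry X i j = (\<Sum>k<r. a k $ i * b k $ j))}"
      by (intro bdd_belowI[of _ 0]) (auto intro!: sum_nonneg mult_nonneg_nonneg max_norm_nonneg)
  qed
  then show ?thesis using 1(4) by linarith
qed

lemma proj_bound_less:
  assumes X: "X \<in> carrier_mat m n" and c: "projective_norm X < c"
  shows "proj_bound m n (entry X) c"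
proof -
  have ne: "{\<Sum>k<r. max_norm (a k) * max_norm (b k) |(r :: nat) a b.
        (\<forall>k<r. a k \<in> carrier_vec m \<and> b k \<in> carrier_vec n) \<and>
        (\<forall>i<m. \<forall>j<n. entry X i j = (\<Sum>k<r. a k $ i * b k $ j))} \<noteq> {}"
    using proj_bound_sum_entries[of m n "entry X"] unfolding proj_bound_def by blast
  show ?thesis
    using cInf_lessD[OF ne, of c] c
    unfolding projective_norm_def carrier_matD[OF X] proj_bound_def by (auto intro: less_imp_le)
qed

lemma projective_norm_nonneg:
  assumes X: "X \<in> carrier_mat m n"
  shows "0 \<le> projective_norm X"
proof (rule ccontr)
  assume "\<not> 0 \<le> projective_norm X"
  then have "proj_bound m n (entry X) (projective_norm X / 2)"
    by (intro proj_bound_less[OF X]) auto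
  then obtain r :: nat and a b where "(\<Sum>k<r. max_norm (a k) * max_norm (b k)) \<le> projective_norm X / 2"
    unfolding proj_bound_def by blast
  moreover have "0 \<le> (\<Sum>k<r. max_norm (a k) * max_norm (b k))"
    by (intro sum_nonneg mult_nonneg_nonneg max_norm_nonneg)
  ultimately show False using \<open>\<not> 0 \<le> projective_norm X\<close> by linarith
qed

section \<open>The little inequality follows from the Grothendieck inequality\<close>

lemma cbF_norm_le_of_projective_norm_le:
  assumes K: "0 \<le> K" "\<And>n X. 0 < n \<Longrightarrow> X \<in> carrier_mat n n \<Longrightarrow> projective_norm X \<le> K * schur_norm X"
    and X: "X \<in> carrier_mat m n" and n: "0 < n"
  shows "cbF_norm X \<le> sqrt K * F_norm X"
proof -
  have "cbF_norm X \<le> sqrt (K * (F_norm X)\<^sup>2)"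
  proof (rule cbF_norm_le_sqrt[OF X n])
    fix G assume G: "correlation n G"
    let ?G = "mat n n (\<lambda>(i, j). G i j)"
    have "projective_norm ?G \<le> K * schur_norm ?G" using n by (intro K) auto
    also have "\<dots> \<le> K * 1" using K(1) schur_norm_correlation_le[OF G] by (intro mult_left_mono)
    finally have pK: "projective_norm ?G \<le> K" by simp
    have "pairing n (gram m (entry X)) G \<le> (K + e) * (F_norm X)\<^sup>2" if "0 < e" for e
    proof -
      have lt: "projective_norm ?G < K + e" using pK that by linarith
      obtain r :: nat and a b where a: "\<And>k. k < r \<Longrightarrow> a k \<in> carrier_vec n" and b: "\<And>k. k < r \<Longrightarrow> b k \<in> carrier_vec n"
        and ab: "\<And>i j. i < n \<Longrightarrow> j < n \<Longrightarrow> entry ?G i j = (\<Sum>k<r. a k $ i * b k $ j)"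
          "(\<Sum>k<r. max_norm (a k) * max_norm (b k)) \<le> K + e"
        using proj_bound_less[OF mat_carrier lt] by (rule proj_boundE) blast
      have "pairing n (gram m (entry X)) G = pairing n (gram m (entry X)) (\<lambda>i j. \<Sum>k<r. a k $ i * b k $ j)"
        using ab(1) by (intro pairing_cong) auto
      also have "\<dots> \<le> (\<Sum>k<r. max_norm (a k) * max_norm (b k) * (F_norm X)\<^sup>2)"
        unfolding pairing_sum
      proof (intro sum_mono pairing_gram_le[OF X] max_norm_nonneg)
        fix k i assume "k \<in> {..<r}" "i < n"
        then show "cmod (a k $ i) \<le> max_norm (a k)" "cmod (b k $ i) \<le> max_norm (b k)"
          using a[of k] b[of k] by (auto intro!: norm_le_max_norm)
      qed
      also have "\<dots> \<le> (K + e) * (F_norm X)\<^sup>2"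
        unfolding sum_distrib_right[symmetric] using ab(2) by (intro mult_right_mono) auto
      finally show ?thesis .
    qed
    note le = this
    have "pairing n (gram m (entry X)) G \<le> K * (F_norm X)\<^sup>2 + e" if e: "0 < e" for e
    proof -
      have "(K + e / ((F_norm X)\<^sup>2 + 1)) * (F_norm X)\<^sup>2 = K * (F_norm X)\<^sup>2 + e * ((F_norm X)\<^sup>2 / ((F_norm X)\<^sup>2 + 1))"
        by (simp add: algebra_simps)
      also have "\<dots> \<le> K * (F_norm X)\<^sup>2 + e * 1"
        using e by (intro add_left_mono mult_left_mono) (auto simp: field_simps add_pos_nonneg)
      finally show ?thesis using le[of "e / ((F_norm X)\<^sup>2 + 1)"] e by (simp add: add_nonneg_pos)
    qed
    then show "pairing n (gram m (entry X)) G \<le> K * (F_norm X)\<^sup>2" by (rule field_le_epsilon)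
  qed
  also have "\<dots> = sqrt K * F_norm X" using F_norm_nonneg[OF X] by (simp add: real_sqrt_mult)
  finally show ?thesis .
qed

section \<open>Positive semidefinite matrices\<close>

lemma quad_Suc:
  assumes herm: "\<And>j. j < N \<Longrightarrow> A j N = cnj (A N j)"
  shows "quad (Suc N) A w = quad N A w + 2 * Re (cnj (w N) * (\<Sum>j<N. A N j * w j)) + Re (A N N) * (cmod (w N))\<^sup>2"
proof -
  have sq: "Re (A N N * (cnj (w N) * w N)) = Re (A N N) * (cmod (w N))\<^sup>2"
    by (simp only: cmod_power2) (simp add: power2_eq_square algebra_simps)
  have r: "(\<Sum>j<N. Re (A N j * (cnj (w N) * w j))) = Re (cnj (w N) * (\<Sum>j<N. A N j * w j))"
    unfolding Re_sum[symmetric] sum_distrib_left by (intro arg_cong[where f = Re] sum.cong) (auto simp: algebra_simps)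
  have "(\<Sum>i<N. Re (A i N * (cnj (w i) * w N))) = (\<Sum>j<N. Re (A N j * (cnj (w N) * w j)))"
  proof (intro sum.cong refl)
    fix j assume "j \<in> {..<N}"
    then have "A j N * (cnj (w j) * w N) = cnj (A N j * (cnj (w N) * w j))" using herm by (simp add: algebra_simps)
    then show "Re (A j N * (cnj (w j) * w N)) = Re (A N j * (cnj (w N) * w j))" by (metis complex_cnj(1) complex.sel(1) cnj.sel(1))
  qed
  note c = this[unfolded r]
  show ?thesis
    unfolding quad_def pairing_def sum.lessThan_Suc sum.distrib c r sq by simp
qed

lemma quad_minus:
  "quad N (\<lambda>i j. A i j - B i j) v = quad N A v - quad N B v"
  unfolding quad_def pairing_def by (simp add: sum_subtractf left_diff_distrib)

text \<open>Cholesky factorisation, by induction on the size; the inductive step passes to the Schur complement.\<close>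
lemma psd_eq_gram:
  assumes "\<And>i j. i < N \<Longrightarrow> j < N \<Longrightarrow> A j i = cnj (A i j)" "\<And>v. 0 \<le> quad N A v"
  shows "\<exists>X. \<forall>i<N. \<forall>j<N. A i j = gram N X i j"
  using assms
proof (induction N arbitrary: A)
  case 0
  then show ?case by simp
next
  case (Suc N)
  note herm = Suc.prems(1) and psd = Suc.prems(2)
  have Suc_eq: "quad (Suc N) A w = quad N A w + 2 * Re (cnj (w N) * (\<Sum>j<N. A N j * w j)) + Re (A N N) * (cmod (w N))\<^sup>2" for w
    by (rule quad_Suc) (simp add: herm[of N])
  define a where "a = Re (A N N)"
  have aA: "A N N = complex_of_real a"
    using herm[of N N] by (simp add: a_def complex_eq_iff)
  have upd: "quad N A w = quad N A w'" if "\<And>i. i < N \<Longrightarrow> w i = w' i" for w w' and A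
    unfolding quad_def using that by (intro pairing_cong) auto
  have "0 \<le> quad (Suc N) A (\<lambda>i. if i = N then 1 else 0)" by (rule psd)
  also have "\<dots> = a"
  proof -
    have "quad N A (\<lambda>i. if i = N then 1 else 0) = 0" by (simp add: quad_def pairing_def)
    then show ?thesis unfolding Suc_eq by (simp add: a_def)
  qed
  finally have a0: "0 \<le> a" .
  show ?case
  proof (cases "a = 0")
    case True
    \<comment> \<open>A zero on the diagonal of a positive semidefinite matrix forces its row to vanish.\<close>
    have b0: "A N j = 0" if j: "j < N" for j
    proof (rule ccontr)
      assume b: "A N j \<noteq> 0"
      define q where "q = quad N A (\<lambda>i. if i = j then 1 else 0)"
      define s where "s = (\<bar>q\<bar> + 1) / (cmod (A N j))\<^sup>2"
      define w where "w = (\<lambda>i. if i = N then - (complex_of_real s * A N j) else if i = j then 1 else 0)"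
      have "quad N A w = q" unfolding q_def by (rule upd) (auto simp: w_def)
      moreover have "(\<Sum>k<N. A N k * w k) = A N j"
      proof -
        have "(\<Sum>k<N. A N k * w k) = (\<Sum>k<N. if k = j then A N j else 0)"
          by (intro sum.cong) (auto simp: w_def)
        then show ?thesis using j by simp
      qed
      moreover have "Re (cnj (w N) * A N j) = - (s * (cmod (A N j))\<^sup>2)"
        unfolding w_def cmod_power2 by (simp add: power2_eq_square algebra_simps)
      ultimately have "quad (Suc N) A w = q - 2 * (s * (cmod (A N j))\<^sup>2)"
        unfolding Suc_eq using True by (simp add: a_def)
      also have "s * (cmod (A N j))\<^sup>2 = \<bar>q\<bar> + 1" using b by (simp add: s_def)
      finally have "quad (Suc N) A w = q - 2 * (\<bar>q\<bar> + 1)" .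
      moreover have "q - 2 * (\<bar>q\<bar> + 1) < 0" by (cases "0 \<le> q") auto
      ultimately have "quad (Suc N) A w < 0" by (rule ord_eq_less_trans)
      then show False using psd[of w] by (meson not_le)
    qed
    have "0 \<le> quad N A v" for v
    proof -
      have "quad (Suc N) A (\<lambda>i. if i = N then 0 else v i) = quad N A v"
        unfolding Suc_eq by (simp, rule upd) auto
      then show ?thesis using psd[of "\<lambda>i. if i = N then 0 else v i"] by simp
    qed
    then obtain X where X: "\<forall>i<N. \<forall>j<N. A i j = gram N X i j"
      using Suc.IH[of A] herm by (meson less_SucI)
    define X' where "X' = (\<lambda>l i. if l < N \<and> i < N then X l i else 0)"
    have "A i j = gram (Suc N) X' i j" if "i < Suc N" "j < Suc N" for i j
    proof (cases "i < N \<and> j < N")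
      case True
      then show ?thesis using X by (simp add: gram_def X'_def)
    next
      case False
      then have "i = N \<or> j = N" using that by auto
      then have "A i j = 0" using b0 herm[of N i] that aA True by (cases "i = N"; cases "j = N") auto
      moreover have "gram (Suc N) X' i j = 0" using False by (auto simp: gram_def X'_def intro!: sum.neutral)
      ultimately show ?thesis by simp
    qed
    then show ?thesis by blast
  next
    case False
    then have a: "0 < a" using a0 by simp
    define x where "x = (\<lambda>j. A N j / complex_of_real (sqrt a))"
    have sqa: "complex_of_real (sqrt a) * complex_of_real (sqrt a) = complex_of_real a"
      using a by (simp flip: of_real_mult)
    define A' where "A' = (\<lambda>i j. A i j - cnj (x i) * x j)"
    have "0 \<le> quad N A' v" for v
    proof -
      define b where "b = (\<Sum>j<N. A N j * v j)"
      \<comment> \<open>This last coordinate minimises the form of \<open>A\<close>, and the minimum is the form of \<open>A'\<close>.\<close>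
      define w where "w = (\<lambda>i. if i = N then - b / complex_of_real a else v i)"
      have 1: "quad N A w = quad N A v" by (rule upd) (auto simp: w_def)
      have 2: "(\<Sum>j<N. A N j * w j) = b" unfolding b_def by (intro sum.cong) (auto simp: w_def)
      have 3: "Re (cnj (w N) * b) = - ((cmod b)\<^sup>2 / a)"
        unfolding w_def cmod_power2 by (simp add: power2_eq_square add_divide_distrib)
      have 4: "a * (cmod (w N))\<^sup>2 = (cmod b)\<^sup>2 / a"
        using a by (simp add: w_def norm_divide power_divide power2_eq_square)
      have "quad N (gram 1 (\<lambda>_. x)) v = (cmod b)\<^sup>2 / a"
      proof -
        have "mulv N (\<lambda>_. x) v 0 = b / complex_of_real (sqrt a)"
          by (simp add: mulv_def x_def b_def sum_divide_distrib)
        then show ?thesis unfolding quad_gram enorm_sq using a by (simp add: norm_divide power_divide)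
      qed
      moreover have "quad N A' v = quad N A v - quad N (gram 1 (\<lambda>_. x)) v"
        unfolding A'_def quad_minus[symmetric] by (simp add: gram_def)
      moreover have "quad (Suc N) A w = quad N A v - (cmod b)\<^sup>2 / a"
        unfolding Suc_eq 1 2 3 a_def[symmetric] 4 by simp
      ultimately show ?thesis using psd[of w] by simp
    qed
    moreover have "A' j i = cnj (A' i j)" if "i < N" "j < N" for i j
      using herm[of i j] that by (simp add: A'_def)
    ultimately obtain X where X: "\<forall>i<N. \<forall>j<N. A' i j = gram N X i j"
      using Suc.IH[of A'] by blast
    define X' where "X' = (\<lambda>l i. if l < N then (if i < N then X l i else 0) else x i)"
    have g: "gram (Suc N) X' i j = (if i < N \<and> j < N then gram N X i j else 0) + cnj (x i) * x j" for i j
      by (auto simp: gram_def X'_def)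
    have xN: "x N = complex_of_real (sqrt a)"
      unfolding x_def aA using a sqa by (simp add: field_simps)
    have xj: "cnj (x N) * x j = A N j" for j
      unfolding xN using a by (simp add: x_def)
    have "A i j = gram (Suc N) X' i j" if ij: "i < Suc N" "j < Suc N" for i j
    proof (cases "i < N \<and> j < N")
      case True
      then have "A i j - cnj (x i) * x j = gram N X i j" using X by (simp add: A'_def)
      then show ?thesis using True unfolding g by (simp add: diff_eq_eq)
    next
      case False
      then consider "i = N" | "j = N" using ij by linarith
      then have "cnj (x i) * x j = A i j"
      proof cases
        case 1 then show ?thesis using xj by simp
      next
        case 2
        have "cnj (x i) * x N = cnj (cnj (x N) * x i)" by simp
        also have "\<dots> = A i N" using xj[of i] herm[of N i] ij by simp
        finally show ?thesis using 2 by simp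
      qed
      then show ?thesis unfolding g using False by auto
    qed
    then show ?thesis by blast
  qed
qed

section \<open>Bounded bilinear forms\<close>

text \<open>
  The Hermitian matrix with zero diagonal blocks and off-diagonal blocks \<open>Y / 2\<close> and \<open>Y\<^sup>* / 2\<close>, the
  first block having size \<open>m\<close>.
\<close>
definition herm_block :: "nat \<Rightarrow> (nat \<Rightarrow> nat \<Rightarrow> complex) \<Rightarrow> nat \<Rightarrow> nat \<Rightarrow> complex" where
  "herm_block m Y i j = (if i < m \<and> m \<le> j then Y i (j - m) / 2 else if m \<le> i \<and> j < m then cnj (Y j (i - m)) / 2 else 0)"

lemma pairing_herm_block:
  assumes "\<And>i j. i < m + n \<Longrightarrow> j < m + n \<Longrightarrow> G j i = cnj (G i j)"
  shows "pairing (m + n) (herm_block m Y) G = (\<Sum>i<m. \<Sum>j<n. Re (Y i j * G i (m + j)))"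
proof -
  have 1: "(\<Sum>j<m + n. Re (herm_block m Y i j * G i j)) = (\<Sum>j<n. Re (Y i j * G i (m + j)) / 2)" if "i < m" for i
    using that by (simp add: sum_lessThan_add herm_block_def diff_divide_distrib)
  have 2: "(\<Sum>j<m + n. Re (herm_block m Y (m + i) j * G (m + i) j)) = (\<Sum>j<m. Re (Y j i * G j (m + i)) / 2)" if "i < n" for i
  proof -
    have "(\<Sum>j<m + n. Re (herm_block m Y (m + i) j * G (m + i) j)) = (\<Sum>j<m. Re (cnj (Y j i) / 2 * G (m + i) j))"
      by (simp add: sum_lessThan_add herm_block_def add_divide_distrib)
    also have "\<dots> = (\<Sum>j<m. Re (Y j i * G j (m + i)) / 2)"
      proof (rule sum.cong[OF refl])
      fix j assume "j \<in> {..<m}"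
      then have "G (m + i) j = cnj (G j (m + i))" using assms[of j "m + i"] that by simp
      then show "Re (cnj (Y j i) / 2 * G (m + i) j) = Re (Y j i * G j (m + i)) / 2"
        by (simp add: add_divide_distrib)
    qed
    finally show ?thesis .
  qed
  have "pairing (m + n) (herm_block m Y) G =
     (\<Sum>i<m. \<Sum>j<n. Re (Y i j * G i (m + j)) / 2) + (\<Sum>i<n. \<Sum>j<m. Re (Y j i * G j (m + i)) / 2)"
    unfolding pairing_def sum_lessThan_add[of _ m n, where f = "\<lambda>i. \<Sum>j<m + n. F i j" for F] using 1 2 by simp
  also have "(\<Sum>i<n. \<Sum>j<m. Re (Y j i * G j (m + i)) / 2) = (\<Sum>i<m. \<Sum>j<n. Re (Y i j * G i (m + j)) / 2)"
    by (rule sum.swap)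
  finally show ?thesis by (simp flip: sum_divide_distrib)
qed

lemma quad_herm_block:
  "quad (m + n) (herm_block m Y) v = (\<Sum>i<m. \<Sum>j<n. Re (Y i j * (cnj (v i) * v (m + j))))"
  unfolding quad_def by (subst pairing_herm_block) auto

lemma correlation_hermitian:
  assumes "correlation N G" "i < N" "j < N"
  shows "G j i = cnj (G i j)"
proof -
  obtain r and V :: "nat \<Rightarrow> nat \<Rightarrow> complex" where
    G: "\<forall>i<N. \<forall>j<N. G i j = (\<Sum>k<r. cnj (V k i) * V k j)"
    using assms unfolding correlation_def by blast
  then show ?thesis using assms by (simp add: mult.commute)
qed

lemma correlation_diag:
  assumes "correlation N G" "i < N"
  shows "G i i = 1"
proof -
  obtain r and V :: "nat \<Rightarrow> nat \<Rightarrow> complex" where V: "\<forall>i<N. (\<Sum>k<r. (cmod (V k i))\<^sup>2) = 1"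
    and G: "\<forall>i<N. \<forall>j<N. G i j = (\<Sum>k<r. cnj (V k i) * V k j)"
    using assms unfolding correlation_def by blast
  have "G i i = complex_of_real (\<Sum>k<r. (cmod (V k i))\<^sup>2)"
    using G assms(2) unfolding of_real_sum complex_norm_square by (simp add: mult.commute)
  then show ?thesis using V assms(2) by simp
qed

text \<open>Correlation matrices are closed under conjugation with diagonal sign matrices.\<close>
lemma correlation_sign:
  assumes "correlation N G" and s: "\<And>i. s i = 1 \<or> s i = (-1 :: complex)"
  shows "correlation N (\<lambda>i j. s i * s j * G i j)"
proof -
  obtain r and V :: "nat \<Rightarrow> nat \<Rightarrow> complex" where V: "\<forall>i<N. (\<Sum>k<r. (cmod (V k i))\<^sup>2) = 1"
    and G: "\<forall>i<N. \<forall>j<N. G i j = (\<Sum>k<r. cnj (V k i) * V k j)"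
    using assms unfolding correlation_def by blast
  have n: "cmod (s i) = 1" "cnj (s i) = s i" for i using s[of i] by auto
  show ?thesis
    unfolding correlation_def
  proof (intro exI[of _ r] exI[of _ "\<lambda>k i. s i * V k i"] conjI allI impI)
    fix i assume "i < N" then show "(\<Sum>k<r. (cmod (s i * V k i))\<^sup>2) = 1" using V by (simp add: norm_mult n)
  next
    fix i j assume "i < N" "j < N"
    then show "s i * s j * G i j = (\<Sum>k<r. cnj (s i * V k i) * (s j * V k j))"
      using G by (simp add: n sum_distrib_left algebra_simps)
  qed
qed


lemma pairing_diag:
  "pairing N (\<lambda>i j. if i = j then complex_of_real (d i) else 0) G = (\<Sum>i<N. d i * Re (G i i))"
proof -
  have "pairing N (\<lambda>i j. if i = j then complex_of_real (d i) else 0) G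
     = (\<Sum>i<N. \<Sum>j<N. if j = i then d i * Re (G i i) else 0)"
    unfolding pairing_def by (intro sum.cong refl) auto
  then show ?thesis by simp
qed

lemma pairing_minus: "pairing N (\<lambda>i j. A i j - B i j) G = pairing N A G - pairing N B G"
  unfolding pairing_def by (simp add: sum_subtractf left_diff_distrib)

text \<open>The constant \<open>k\<close> is admissible in the little Grothendieck inequality.\<close>
definition little_bound :: "real \<Rightarrow> bool" where
  "little_bound k \<longleftrightarrow> 0 \<le> k \<and> (\<forall>m n X. 0 < m \<longrightarrow> 0 < n \<longrightarrow> X \<in> carrier_mat m n \<longrightarrow>
     cbF_norm X \<le> sqrt k * F_norm X)"

lemma little_boundD:
  "little_bound k \<Longrightarrow> 0 < m \<Longrightarrow> 0 < n \<Longrightarrow> X \<in> carrier_mat m n \<Longrightarrow> cbF_norm X \<le> sqrt k * F_norm X"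
  by (simp add: little_bound_def)

text \<open>The bilinear form of \<open>Y\<close> is bounded by \<open>\<beta>\<close> on pairs of vectors of max norm at most 1.\<close>
definition bilinear_bound :: "nat \<Rightarrow> nat \<Rightarrow> (nat \<Rightarrow> nat \<Rightarrow> complex) \<Rightarrow> real \<Rightarrow> bool" where
  "bilinear_bound m n Y \<beta> \<longleftrightarrow> (\<forall>a b. (\<forall>i<m. cmod (a i) \<le> 1) \<longrightarrow> (\<forall>j<n. cmod (b j) \<le> 1) \<longrightarrow>
     cmod (\<Sum>i<m. \<Sum>j<n. Y i j * (a i * b j)) \<le> \<beta>)"

text \<open>
  Weights that majorise the form of \<open>Y\<close>. Their total mass is controlled by the little inequality,
  applied to a square root of the difference between the majorant and \<open>herm_block m Y\<close>.
\<close>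
lemma bilinear_majorant:
  fixes m n :: nat and Y :: "nat \<Rightarrow> nat \<Rightarrow> complex"
  assumes little: "little_bound k"
    and Y: "bilinear_bound m n Y \<beta>"
    and mn: "0 < m + n" and e: "0 < e"
  obtains z where "\<And>i. i < m + n \<Longrightarrow> 0 < z i" "(2 - k) * (\<Sum>i<m + n. z i) \<le> k * \<beta> + e"
    "\<And>v. (\<Sum>i<m. \<Sum>j<n. Re (Y i j * (cnj (v i) * v (m + j)))) \<le> (\<Sum>i<m + n. z i * (cmod (v i))\<^sup>2)"
proof -
  let ?N = "m + n" and ?H = "herm_block m Y"
  have k: "0 \<le> k" using little by (simp add: little_bound_def)
  define M where "M = Sup {pairing ?N ?H G |G. correlation ?N G}"
  have ne: "{pairing ?N ?H G |G. correlation ?N G} \<noteq> {}" using correlation_id by blast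
  have bdd: "bdd_above {pairing ?N ?H G |G. correlation ?N G}"
    using abs_pairing_le[of ?N _ ?H] by (intro bdd_aboveI) (auto simp: abs_le_iff)
  have upM: "pairing ?N ?H G \<le> M" if "correlation ?N G" for G
    unfolding M_def using that by (intro cSup_upper bdd) blast
  have Hdiag: "0 \<le> Re (?H i i)" for i by (simp add: herm_block_def)
  obtain z where z: "\<And>i. i < ?N \<Longrightarrow> 0 < z i" "(\<Sum>i<?N. z i) \<le> M + e"
    "\<And>v. quad ?N ?H v \<le> (\<Sum>i<?N. z i * (cmod (v i))\<^sup>2)"
    using diagonal_majorant[of ?N ?H, OF Hdiag upM e] by blast
  define S where "S = (\<Sum>i<?N. z i)"
  define D where "D = (\<lambda>i j. if i = j then complex_of_real (z i) else 0)"
  have quadD: "quad ?N D v = (\<Sum>i<?N. z i * (cmod (v i))\<^sup>2)" for v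
    by (rule quad_diag) (simp add: D_def)
  have "\<exists>X. \<forall>i<?N. \<forall>j<?N. D i j - ?H i j = gram ?N X i j"
  proof (rule psd_eq_gram)
    show "D j i - ?H j i = cnj (D i j - ?H i j)" for i j
      by (cases "i < m"; cases "j < m") (auto simp: D_def herm_block_def)
    show "0 \<le> quad ?N (\<lambda>i j. D i j - ?H i j) v" for v
      unfolding quad_minus quadD using z(3)[of v] by simp
  qed
  then obtain X where X: "\<forall>i<?N. \<forall>j<?N. D i j - ?H i j = gram ?N X i j" by blast
  define X0 where "X0 = mat ?N ?N (\<lambda>(i, j). X i j)"
  have X0: "X0 \<in> carrier_mat ?N ?N" by (simp add: X0_def)
  have g: "gram ?N (entry X0) i j = D i j - ?H i j" if "i < ?N" "j < ?N" for i j
    using X that by (simp add: gram_def X0_def)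
  have pg: "pairing ?N (gram ?N (entry X0)) G = pairing ?N D G - pairing ?N ?H G" for G
    unfolding pairing_minus[symmetric] by (rule pairing_cong) (simp_all add: g)
  have Hneg: "- quad ?N ?H v \<le> \<beta>" if v: "\<And>i. i < ?N \<Longrightarrow> cmod (v i) \<le> 1" for v
  proof -
    have "- quad ?N ?H v \<le> cmod (\<Sum>i<m. \<Sum>j<n. Y i j * (cnj (v i) * v (m + j)))"
      unfolding quad_herm_block Re_sum[symmetric] using abs_Re_le_cmod abs_le_D2 by blast
    also have "\<dots> \<le> \<beta>" using Y v unfolding bilinear_bound_def by simp
    finally show ?thesis .
  qed
  have "F_norm X0 \<le> sqrt (S + \<beta>)"
  proof (rule F_norm_least[OF X0])
    fix v :: "nat \<Rightarrow> complex" assume v: "\<And>j. j < ?N \<Longrightarrow> cmod (v j) \<le> 1"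
    have "(enorm ?N (mulv ?N (entry X0) v))\<^sup>2 = quad ?N D v - quad ?N ?H v"
      unfolding quad_gram[symmetric] unfolding quad_def by (rule pg)
    also have "\<dots> \<le> S - quad ?N ?H v"
      unfolding quadD S_def
    proof (intro diff_right_mono sum_mono)
      fix i assume "i \<in> {..<?N}"
      then have "z i * (cmod (v i))\<^sup>2 \<le> z i * 1" using z(1)[of i] v[of i] by (intro mult_left_mono) (auto simp: power_le_one)
      then show "z i * (cmod (v i))\<^sup>2 \<le> z i" by simp
    qed
    finally have "(enorm ?N (mulv ?N (entry X0) v))\<^sup>2 \<le> S + \<beta>" using Hneg[of v] v by fastforce
    then show "enorm ?N (mulv ?N (entry X0) v) \<le> sqrt (S + \<beta>)" by (rule real_le_rsqrt)
  qed
  moreover have "0 \<le> S + \<beta>"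
  proof -
    have "0 \<le> \<beta>" using Y unfolding bilinear_bound_def by (auto dest!: spec[of _ "\<lambda>_. 0"])
    moreover have "0 \<le> S" unfolding S_def using z(1) by (intro sum_nonneg) (auto intro: less_imp_le)
    ultimately show ?thesis by simp
  qed
  ultimately have F: "(F_norm X0)\<^sup>2 \<le> S + \<beta>"
    using F_norm_nonneg[OF X0] power_mono[of "F_norm X0" "sqrt (S + \<beta>)" 2] by simp
  have "S + pairing ?N ?H G \<le> k * (S + \<beta>)" if G: "correlation ?N G" for G
  proof -
    \<comment> \<open>Flipping the sign of the second group of vectors negates the pairing with the block matrix.\<close>
    define s :: "nat \<Rightarrow> complex" where "s = (\<lambda>i. if i < m then 1 else -1)"
    define G' where "G' = (\<lambda>i j. s i * s j * G i j)"
    have G': "correlation ?N G'" unfolding G'_def by (rule correlation_sign[OF G]) (auto simp: s_def)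
    have "pairing ?N D G' = S"
      unfolding D_def pairing_diag S_def using correlation_diag[OF G'] by (intro sum.cong) auto
    moreover have "pairing ?N ?H G' = - pairing ?N ?H G"
    proof -
      have 1: "pairing ?N ?H G = (\<Sum>i<m. \<Sum>j<n. Re (Y i j * G i (m + j)))"
        by (rule pairing_herm_block) (rule correlation_hermitian[OF G])
      have 2: "pairing ?N ?H G' = (\<Sum>i<m. \<Sum>j<n. Re (Y i j * G' i (m + j)))"
        by (rule pairing_herm_block) (rule correlation_hermitian[OF G'])
      show ?thesis unfolding 1 2 sum_negf[symmetric]
        by (intro sum.cong refl) (simp add: G'_def s_def)
    qed
    moreover have "pairing ?N (gram ?N (entry X0)) G' \<le> (cbF_norm X0)\<^sup>2"
      by (rule pairing_gram_le_cbF_norm[OF X0 mn G'])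
    moreover have "(cbF_norm X0)\<^sup>2 \<le> (sqrt k * F_norm X0)\<^sup>2"
      by (rule power_mono[OF little_boundD[OF little mn mn X0] cbF_norm_nonneg[OF X0 mn]])
    moreover have "(sqrt k * F_norm X0)\<^sup>2 \<le> k * (S + \<beta>)"
      using k F by (simp add: power_mult_distrib mult_left_mono)
    ultimately show ?thesis unfolding pg by linarith
  qed
  then have "M \<le> k * (S + \<beta>) - S"
    unfolding M_def by (intro cSup_least ne) (auto simp: algebra_simps)
  then have "(2 - k) * S \<le> k * \<beta> + e"
    using z(2) unfolding S_def[symmetric] by (simp add: algebra_simps)
  then show thesis
    using that[of z] z unfolding S_def quad_herm_block by blast
qed

text \<open>
  With \<open>\<eta>\<close> and \<open>\<xi>\<close> the square roots of the two groups of weights, the majorant says that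
  \<open>Y i j = 2 * \<eta> i * B i j * \<xi> j\<close> with a contraction \<open>B\<close>, so that the sum is twice the bilinear form of
  \<open>X \<circ> B\<close> at \<open>\<eta>\<close> and \<open>\<xi>\<close>.
\<close>
lemma schur_duality:
  fixes m n :: nat and Y :: "nat \<Rightarrow> nat \<Rightarrow> complex"
  assumes little: "little_bound k" and k2: "k < 2"
    and Y: "bilinear_bound m n Y \<beta>"
    and X: "X \<in> carrier_mat m n" and mn: "0 < m + n"
  shows "(\<Sum>i<m. \<Sum>j<n. Re (Y i j * entry X i j)) \<le> k / (2 - k) * \<beta> * schur_norm X"
proof -
  have k: "0 \<le> k" "k < 2" using little k2 by (auto simp: little_bound_def)
  have key: "(2 - k) * (\<Sum>i<m. \<Sum>j<n. Re (Y i j * entry X i j)) \<le> (k * \<beta> + e) * schur_norm X"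
    if e: "0 < e" for e
  proof -
    obtain z where z: "\<And>i. i < m + n \<Longrightarrow> 0 < z i" "(2 - k) * (\<Sum>i<m + n. z i) \<le> k * \<beta> + e"
      "\<And>v. (\<Sum>i<m. \<Sum>j<n. Re (Y i j * (cnj (v i) * v (m + j)))) \<le> (\<Sum>i<m + n. z i * (cmod (v i))\<^sup>2)"
      using bilinear_majorant[OF little Y mn e] by blast
    define \<eta> where "\<eta> = (\<lambda>i. sqrt (z i))"
    define \<xi> where "\<xi> = (\<lambda>j. sqrt (z (m + j)))"
    have \<eta>: "0 < \<eta> i" "(\<eta> i)\<^sup>2 = z i" if "i < m" for i
      using z(1)[of i] that by (auto simp: \<eta>_def less_imp_le)
    have \<xi>: "0 < \<xi> j" "(\<xi> j)\<^sup>2 = z (m + j)" if "j < n" for j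
      using z(1)[of "m + j"] that by (auto simp: \<xi>_def less_imp_le)
    define B where "B = mat m n (\<lambda>(i, j). Y i j / (2 * complex_of_real (\<eta> i) * complex_of_real (\<xi> j)))"
    have B: "B \<in> carrier_mat m n" by (simp add: B_def)
    have YB: "Y i j = 2 * complex_of_real (\<eta> i) * complex_of_real (\<xi> j) * entry B i j" if "i < m" "j < n" for i j
      using \<eta>(1)[OF that(1)] \<xi>(1)[OF that(2)] that by (simp add: B_def)
    have "op_norm B \<le> 1"
    proof (rule op_norm_least[OF B])
      fix w
      define u where "u = mulv n (entry B) w"
      define v where "v = (\<lambda>i. if i < m then u i / complex_of_real (\<eta> i) else w (i - m) / complex_of_real (\<xi> (i - m)))"
      have "(\<Sum>i<m. \<Sum>j<n. Re (Y i j * (cnj (v i) * v (m + j)))) = (\<Sum>i<m. Re (2 * (cnj (u i) * u i)))"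
      proof (rule sum.cong[OF refl])
        fix i assume "i \<in> {..<m}"
        then have i: "i < m" by simp
        have "(\<Sum>j<n. Y i j * (cnj (v i) * v (m + j))) = (\<Sum>j<n. 2 * (cnj (u i) * (entry B i j * w j)))"
        proof (rule sum.cong[OF refl])
          fix j assume "j \<in> {..<n}"
          then have j: "j < n" by simp
          show "Y i j * (cnj (v i) * v (m + j)) = 2 * (cnj (u i) * (entry B i j * w j))"
            unfolding YB[OF i j] using i j \<eta>(1)[OF i] \<xi>(1)[OF j] by (simp add: v_def)
        qed
        also have "\<dots> = 2 * (cnj (u i) * u i)"
          by (simp add: u_def mulv_def sum_distrib_left)
        finally show "(\<Sum>j<n. Re (Y i j * (cnj (v i) * v (m + j)))) = Re (2 * (cnj (u i) * u i))"
          unfolding Re_sum[symmetric] by (rule arg_cong[where f = Re])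
      qed
      also have "\<dots> = 2 * (enorm m u)\<^sup>2"
      proof -
        have "Re (2 * (cnj a * a)) = 2 * (cmod a)\<^sup>2" for a
          by (simp only: cmod_power2) (simp add: power2_eq_square)
        then show ?thesis unfolding enorm_sq sum_distrib_left by simp
      qed
      finally have "2 * (enorm m u)\<^sup>2 \<le> (\<Sum>i<m + n. z i * (cmod (v i))\<^sup>2)" using z(3)[of v] by simp
      also have "\<dots> = (enorm m u)\<^sup>2 + (enorm n w)\<^sup>2"
      proof -
        have "z i * (cmod (v i))\<^sup>2 = (cmod (u i))\<^sup>2" if "i < m" for i
          using \<eta>[OF that] that by (simp add: v_def norm_divide power_divide less_imp_neq[symmetric] flip: \<eta>(2)[OF that])
        moreover have "z (m + j) * (cmod (v (m + j)))\<^sup>2 = (cmod (w j))\<^sup>2" if "j < n" for j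
          using \<xi>[OF that] that by (simp add: v_def norm_divide power_divide less_imp_neq[symmetric] flip: \<xi>(2)[OF that])
        ultimately show ?thesis unfolding sum_lessThan_add enorm_sq by simp
      qed
      finally have "(enorm m u)\<^sup>2 \<le> (enorm n w)\<^sup>2" by simp
      then show "enorm m (mulv n (entry B) w) \<le> 1 * enorm n w"
        unfolding mult_1 u_def by (rule power2_le_imp_le) simp
    qed simp
    then have XB: "op_norm (schur_product X B) \<le> schur_norm X" by (rule schur_norm_upper[OF X B])
    define p where "p = enorm m (\<lambda>i. complex_of_real (\<eta> i))"
    define q where "q = enorm n (\<lambda>j. complex_of_real (\<xi> j))"
    have pq: "p\<^sup>2 + q\<^sup>2 = (\<Sum>i<m + n. z i)"
      unfolding p_def q_def enorm_sq sum_lessThan_add using \<eta>(2) \<xi>(2) by simp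
    let ?u = "mulv n (entry (schur_product X B)) (\<lambda>j. complex_of_real (\<xi> j))"
    have "(\<Sum>i<m. \<Sum>j<n. Re (Y i j * entry X i j)) = Re (2 * (\<Sum>i<m. complex_of_real (\<eta> i) * ?u i))"
      unfolding Re_sum[symmetric] sum_distrib_left mulv_def
      by (intro arg_cong[where f = Re] sum.cong refl) (simp add: YB entry_schur_product[OF X])
    also have "\<dots> \<le> cmod (2 * (\<Sum>i<m. complex_of_real (\<eta> i) * ?u i))" by (rule complex_Re_le_cmod)
    also have "\<dots> \<le> 2 * (p * enorm m ?u)"
      unfolding norm_mult p_def using enorm_cauchy_schwarz[of "\<lambda>i. complex_of_real (\<eta> i)" ?u m] by simp
    also have "\<dots> \<le> 2 * (p * (schur_norm X * q))"
    proof -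
      have "enorm m ?u \<le> op_norm (schur_product X B) * q"
        unfolding q_def by (rule op_norm_upper[OF schur_product_carrier[OF X]])
      also have "\<dots> \<le> schur_norm X * q" using XB by (intro mult_right_mono) (auto simp: q_def)
      finally show ?thesis by (intro mult_left_mono) (auto simp: p_def)
    qed
    also have "\<dots> = (2 * p * q) * schur_norm X" by simp
    also have "\<dots> \<le> (\<Sum>i<m + n. z i) * schur_norm X"
      unfolding pq[symmetric] using sum_squares_bound[of p q] schur_norm_nonneg[OF X] by (intro mult_right_mono)
    finally have "(2 - k) * (\<Sum>i<m. \<Sum>j<n. Re (Y i j * entry X i j)) \<le> (2 - k) * ((\<Sum>i<m + n. z i) * schur_norm X)"
      using k by (intro mult_left_mono) auto
    also have "\<dots> \<le> (k * \<beta> + e) * schur_norm X"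
      unfolding mult.assoc[symmetric] using z(2) schur_norm_nonneg[OF X] by (intro mult_right_mono)
    finally show ?thesis .
  qed
  define s where "s = schur_norm X"
  have s: "0 \<le> s" unfolding s_def by (rule schur_norm_nonneg[OF X])
  have "(2 - k) * (\<Sum>i<m. \<Sum>j<n. Re (Y i j * entry X i j)) \<le> k * \<beta> * s + e" if e: "0 < e" for e
  proof -
    have "(k * \<beta> + e / (s + 1)) * s = k * \<beta> * s + e * (s / (s + 1))" by (simp add: algebra_simps)
    also have "\<dots> \<le> k * \<beta> * s + e * 1"
      using e s by (intro add_left_mono mult_left_mono) auto
    finally show ?thesis using key[of "e / (s + 1)"] e s unfolding s_def[symmetric] by simp
  qed
  then have "(2 - k) * (\<Sum>i<m. \<Sum>j<n. Re (Y i j * entry X i j)) \<le> k * \<beta> * s" by (rule field_le_epsilon)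
  then show ?thesis using k unfolding s_def[symmetric] by (simp add: pos_le_divide_eq mult.commute)
qed

section \<open>Duality for the projective norm\<close>

text \<open>
  Separation of a point from a convex set at positive Euclidean distance, in coordinates indexed by
  \<open>I\<close>. The functional is given by the difference between the point and a nearly closest element of \<open>C\<close>,
  so the set need not be closed; boundedness makes the error uniform.
\<close>
lemma convex_separation:
  fixes C :: "('i \<Rightarrow> complex) set" and X :: "'i \<Rightarrow> complex"
  assumes conv: "\<And>Z W s. Z \<in> C \<Longrightarrow> W \<in> C \<Longrightarrow> 0 \<le> s \<Longrightarrow> s \<le> 1 \<Longrightarrow>
      (\<lambda>p. complex_of_real (1 - s) * Z p + complex_of_real s * W p) \<in> C"
    and ne: "C \<noteq> {}" and bd: "\<And>Z p. Z \<in> C \<Longrightarrow> p \<in> I \<Longrightarrow> cmod (Z p) \<le> R"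
    and far: "\<And>Z. Z \<in> C \<Longrightarrow> \<delta> \<le> (\<Sum>p\<in>I. (cmod (X p - Z p))\<^sup>2)" and \<delta>: "0 < \<delta>"
  obtains Y \<alpha> where "\<And>Z. Z \<in> C \<Longrightarrow> (\<Sum>p\<in>I. Re (Y p * Z p)) \<le> \<alpha>" "\<alpha> < (\<Sum>p\<in>I. Re (Y p * X p))"
proof -
  define D where "D = (\<lambda>Z. \<Sum>p\<in>I. (cmod (X p - Z p))\<^sup>2)"
  define B where "B = (\<Sum>p\<in>I. (2 * R)\<^sup>2)"
  have B: "0 \<le> B" unfolding B_def by (intro sum_nonneg) auto
  define s where "s = min 1 (\<delta> / (1 + B))"
  have s: "0 < s" "s \<le> 1" using \<delta> B by (auto simp: s_def)
  have "s \<le> \<delta> / (1 + B)" by (simp add: s_def)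
  then have s\<delta>: "s * (1 + B) \<le> \<delta>" using B by (simp add: pos_le_divide_eq)
  have bdd: "bdd_below (D ` C)" by (intro bdd_belowI[of _ 0]) (auto simp: D_def intro!: sum_nonneg)
  have "Inf (D ` C) < Inf (D ` C) + s\<^sup>2" using s by simp
  from cInf_lessD[OF _ this] ne obtain c where c: "c \<in> C" and Dc: "D c < Inf (D ` C) + s\<^sup>2"
    by auto
  have opt: "D c \<le> D Z + s\<^sup>2" if "Z \<in> C" for Z
    using cInf_lower[OF imageI[OF that] bdd] Dc by linarith
  define Y where "Y = (\<lambda>p. cnj (X p - c p))"
  have le: "(\<Sum>p\<in>I. Re (Y p * (Z p - c p))) \<le> \<delta> / 2" if Z: "Z \<in> C" for Z
  proof -
    define W where "W = (\<lambda>p. complex_of_real (1 - s) * c p + complex_of_real s * Z p)"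
    have "W \<in> C" unfolding W_def using c Z s by (intro conv) auto
    then have "D c \<le> D W + s\<^sup>2" by (rule opt)
    have sq: "(cmod (x - complex_of_real s * z))\<^sup>2 = (cmod x)\<^sup>2 - 2 * s * Re (cnj x * z) + s\<^sup>2 * (cmod z)\<^sup>2" for x z
      unfolding cmod_power2 by (simp add: power2_eq_square algebra_simps)
    have "D W = (\<Sum>p\<in>I. (cmod (X p - c p))\<^sup>2 - 2 * s * Re (Y p * (Z p - c p)) + s\<^sup>2 * (cmod (Z p - c p))\<^sup>2)"
      unfolding D_def
    proof (rule sum.cong[OF refl])
      fix p
      have XW: "X p - W p = (X p - c p) - complex_of_real s * (Z p - c p)"
        unfolding W_def of_real_diff by (simp add: algebra_simps)
      show "(cmod (X p - W p))\<^sup>2 = (cmod (X p - c p))\<^sup>2 - 2 * s * Re (Y p * (Z p - c p)) + s\<^sup>2 * (cmod (Z p - c p))\<^sup>2"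
        unfolding XW Y_def by (rule sq)
    qed
    also have "\<dots> = D c - 2 * s * (\<Sum>p\<in>I. Re (Y p * (Z p - c p))) + s\<^sup>2 * (\<Sum>p\<in>I. (cmod (Z p - c p))\<^sup>2)"
      unfolding D_def sum.distrib sum_subtractf sum_distrib_left by simp
    also have "\<dots> \<le> D c - 2 * s * (\<Sum>p\<in>I. Re (Y p * (Z p - c p))) + s\<^sup>2 * B"
      unfolding B_def
    proof (intro add_left_mono mult_left_mono sum_mono power_mono)
      fix p assume p: "p \<in> I"
      show "cmod (Z p - c p) \<le> 2 * R"
        using norm_triangle_ineq4[of "Z p" "c p"] bd[OF Z p] bd[OF c p] by linarith
    qed auto
    finally have "s * (2 * (\<Sum>p\<in>I. Re (Y p * (Z p - c p)))) \<le> s * (s * (1 + B))"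
      using \<open>D c \<le> D W + s\<^sup>2\<close> by (simp add: algebra_simps power2_eq_square)
    then have "2 * (\<Sum>p\<in>I. Re (Y p * (Z p - c p))) \<le> s * (1 + B)" using s by simp
    then show ?thesis using s\<delta> by linarith
  qed
  have split: "(\<Sum>p\<in>I. Re (Y p * (Z p - c p))) = (\<Sum>p\<in>I. Re (Y p * Z p)) - (\<Sum>p\<in>I. Re (Y p * c p))" for Z
    unfolding right_diff_distrib minus_complex.sel sum_subtractf ..
  show thesis
  proof
    show "(\<Sum>p\<in>I. Re (Y p * Z p)) \<le> (\<Sum>p\<in>I. Re (Y p * c p)) + \<delta> / 2" if "Z \<in> C" for Z
      using le[OF that] unfolding split by simp
    have "(\<Sum>p\<in>I. Re (Y p * (X p - c p))) = D c"
      unfolding D_def Y_def Re_cnj_mult_self ..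
    moreover have "\<delta> \<le> D c" unfolding D_def by (rule far[OF c])
    ultimately show "(\<Sum>p\<in>I. Re (Y p * c p)) + \<delta> / 2 < (\<Sum>p\<in>I. Re (Y p * X p))"
      using \<delta> unfolding split by linarith
  qed
qed

text \<open>
  Separating \<open>X\<close> from the matrices of projective norm at most \<open>T\<close>. A matrix close to one of them
  in Euclidean norm exceeds \<open>T\<close> only slightly in projective norm, so \<open>X\<close> has positive distance.
\<close>
lemma projective_norm_le_of_duality:
  assumes X: "X \<in> carrier_mat m n" and T: "0 < T"
    and dual: "\<And>Y \<beta>. bilinear_bound m n Y \<beta> \<Longrightarrow> (\<Sum>i<m. \<Sum>j<n. Re (Y i j * entry X i j)) \<le> \<beta> * T"
  shows "projective_norm X \<le> T"
proof (rule ccontr)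
  assume "\<not> projective_norm X \<le> T"
  then obtain T' where T': "T < T'" "T' < projective_norm X"
    using dense[of T "projective_norm X"] by auto
  have far0: "\<not> proj_bound m n (entry X) T'" using projective_norm_le[OF X] T' by fastforce
  define I where "I = {..<m} \<times> {..<n}"
  define C where "C = {Z. proj_bound m n (\<lambda>i j. Z (i, j)) T}"
  define N where "N = real m * real n + 1"
  have N: "0 < N" by (simp add: N_def add_nonneg_pos)
  define d where "d = (T' - T) / N"
  have d: "0 < d" using T' N by (simp add: d_def)
  have conv: "(\<lambda>p. complex_of_real (1 - s) * Z p + complex_of_real s * W p) \<in> C"
    if "Z \<in> C" "W \<in> C" "0 \<le> s" "s \<le> 1" for Z W s
  proof -
    have "proj_bound m n (\<lambda>i j. complex_of_real (1 - s) * Z (i, j) + complex_of_real s * W (i, j)) ((1 - s) * T + s * T)"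
      using that unfolding C_def by (intro proj_bound_add proj_bound_scale) auto
    then show ?thesis unfolding C_def by (simp add: left_diff_distrib)
  qed
  have "proj_bound m n (\<lambda>i j. 0) T" by (rule proj_bound_cong[OF proj_bound_zero]) (use T in auto)
  then have ne: "C \<noteq> {}" unfolding C_def by (auto intro!: exI[of _ "\<lambda>_. 0"])
  have bd: "cmod (Z p) \<le> T" if "Z \<in> C" "p \<in> I" for Z p
    using that norm_le_proj_bound unfolding C_def I_def by (cases p) fastforce
  have far: "d\<^sup>2 \<le> (\<Sum>p\<in>I. (cmod ((\<lambda>(i, j). entry X i j) p - Z p))\<^sup>2)" if Z: "Z \<in> C" for Z
  proof (rule ccontr)
    assume "\<not> d\<^sup>2 \<le> (\<Sum>p\<in>I. (cmod ((\<lambda>(i, j). entry X i j) p - Z p))\<^sup>2)"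
    then have less: "(\<Sum>p\<in>I. (cmod ((\<lambda>(i, j). entry X i j) p - Z p))\<^sup>2) < d\<^sup>2" by simp
    have small: "cmod (entry X i j - Z (i, j)) \<le> d" if "i < m" "j < n" for i j
    proof -
      have "(i, j) \<in> I" using that by (simp add: I_def)
      then have "(cmod ((\<lambda>(i, j). entry X i j) (i, j) - Z (i, j)))\<^sup>2 \<le> (\<Sum>p\<in>I. (cmod ((\<lambda>(i, j). entry X i j) p - Z p))\<^sup>2)"
        by (intro member_le_sum) (auto simp: I_def)
      then have "(cmod (entry X i j - Z (i, j)))\<^sup>2 \<le> d\<^sup>2" using less by simp
      then show ?thesis by (rule power2_le_imp_le) (use d in simp)
    qed
    have "(\<Sum>i<m. \<Sum>j<n. cmod (entry X i j - Z (i, j))) \<le> (\<Sum>i<m. \<Sum>j<n. d)"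
      using small by (intro sum_mono) auto
    also have "\<dots> = real m * real n * d" by simp
    also have "\<dots> \<le> N * d" using d by (simp add: N_def algebra_simps)
    also have "\<dots> = T' - T" using N by (simp add: d_def)
    finally have "proj_bound m n (\<lambda>i j. entry X i j - Z (i, j)) (T' - T)"
      by (intro proj_bound_cong[OF proj_bound_sum_entries]) auto
    from proj_bound_add[OF this, of "\<lambda>i j. Z (i, j)" T] Z far0 show False
      unfolding C_def by simp
  qed
  obtain Y \<alpha> where Y: "\<And>Z. Z \<in> C \<Longrightarrow> (\<Sum>p\<in>I. Re (Y p * Z p)) \<le> \<alpha>"
    and \<alpha>: "\<alpha> < (\<Sum>p\<in>I. Re (Y p * (\<lambda>(i, j). entry X i j) p))"
    by (rule convex_separation[where C = C and I = I and R = T and \<delta> = "d\<^sup>2" and X = "\<lambda>(i, j). entry X i j"])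
      (use conv ne bd far zero_less_power[OF d] in \<open>blast+\<close>)
  have dbl: "(\<Sum>p\<in>I. f p) = (\<Sum>i<m. \<Sum>j<n. f (i, j))" for f :: "nat \<times> nat \<Rightarrow> real"
    unfolding I_def by (simp add: sum.cartesian_product)
  have "bilinear_bound m n (\<lambda>i j. Y (i, j)) (\<alpha> / T)"
    unfolding bilinear_bound_def
  proof (intro allI impI)
    fix a b :: "nat \<Rightarrow> complex"
    assume a: "\<forall>i<m. cmod (a i) \<le> 1" and b: "\<forall>j<n. cmod (b j) \<le> 1"
    define \<sigma> where "\<sigma> = (\<Sum>i<m. \<Sum>j<n. Y (i, j) * (a i * b j))"
    \<comment> \<open>A phase that makes the value of the form real and nonnegative.\<close>
    define c where "c = cnj (sgn \<sigma>)"
    have c: "cmod c \<le> 1" by (simp add: c_def norm_sgn)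
    have c\<sigma>: "c * \<sigma> = complex_of_real (cmod \<sigma>)"
      unfolding c_def sgn_eq by (simp add: complex_norm_square[symmetric] power2_eq_square mult.commute[of "cnj \<sigma>"])
    define Z where "Z = (\<lambda>(i, j). (complex_of_real T * c * a i) * b j)"
    have "proj_bound m n (\<lambda>i j. (complex_of_real T * c * a i) * b j) (T * 1)"
    proof (rule proj_bound_rank_one)
      fix i assume "i < m"
      then have "cmod c * cmod (a i) \<le> 1 * 1" using a c by (intro mult_mono) auto
      then show "cmod (complex_of_real T * c * a i) \<le> T" using T by (simp add: norm_mult mult.assoc mult_left_le)
    qed (use b T in auto)
    then have "Z \<in> C" by (simp add: C_def Z_def)
    then have "(\<Sum>i<m. \<Sum>j<n. Re (Y (i, j) * Z (i, j))) \<le> \<alpha>" using Y unfolding dbl by blast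
    also have "(\<Sum>i<m. \<Sum>j<n. Re (Y (i, j) * Z (i, j))) = Re (complex_of_real T * (c * \<sigma>))"
      unfolding \<sigma>_def sum_distrib_left Re_sum[symmetric]
      by (intro arg_cong[where f = Re] sum.cong refl) (simp add: Z_def algebra_simps)
    also have "\<dots> = T * cmod \<sigma>" unfolding c\<sigma> by simp
    finally show "cmod (\<Sum>i<m. \<Sum>j<n. Y (i, j) * (a i * b j)) \<le> \<alpha> / T"
      using T unfolding \<sigma>_def by (simp add: pos_le_divide_eq mult.commute)
  qed
  from dual[OF this] \<alpha> T show False unfolding dbl by simp
qed

lemma projective_norm_le_schur_norm:
  assumes little: "little_bound k" and k2: "k < 2"
    and X: "X \<in> carrier_mat m n" and mn: "0 < m + n"
  shows "projective_norm X \<le> k / (2 - k) * schur_norm X"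
proof (rule field_le_epsilon)
  fix e :: real assume e: "0 < e"
  have "0 \<le> k" using little by (simp add: little_bound_def)
  then have K: "0 \<le> k / (2 - k) * schur_norm X" using k2 schur_norm_nonneg[OF X] by simp
  show "projective_norm X \<le> k / (2 - k) * schur_norm X + e"
  proof (rule projective_norm_le_of_duality[OF X])
    show "0 < k / (2 - k) * schur_norm X + e" using K e by linarith
    fix Y \<beta> assume Y: "bilinear_bound m n Y \<beta>"
    then have "cmod (\<Sum>i<m. \<Sum>j<n. Y i j * (0 * 0)) \<le> \<beta>" unfolding bilinear_bound_def
      by (elim allE[of _ "\<lambda>_. 0"]) simp
    then have \<beta>: "0 \<le> \<beta>" by simp
    have "(\<Sum>i<m. \<Sum>j<n. Re (Y i j * entry X i j)) \<le> k / (2 - k) * \<beta> * schur_norm X"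
      by (rule schur_duality[OF little k2 Y X mn])
    also have "\<dots> \<le> \<beta> * (k / (2 - k) * schur_norm X + e)" using \<beta> e by (simp add: algebra_simps)
    finally show "(\<Sum>i<m. \<Sum>j<n. Re (Y i j * entry X i j)) \<le> \<beta> * (k / (2 - k) * schur_norm X + e)" .
  qed
qed

section \<open>The constant \<open>pi / 2\<close> is admissible in the little inequality\<close>

text \<open>The distribution of a sequence of independent standard real Gaussian variables, the coordinates.\<close>
definition gaussian_product :: "(nat \<Rightarrow> real) measure" where
  "gaussian_product = Pi\<^sub>M UNIV (\<lambda>_. density lborel (normal_density 0 1))"

lemma prob_space_gaussian_product: "prob_space gaussian_product"
  unfolding gaussian_product_def
  by (intro prob_space_PiM prob_space_normal_density) simp

lemma sets_gaussian_product: "sets gaussian_product = sets (Pi\<^sub>M UNIV (\<lambda>_. borel))"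
  unfolding gaussian_product_def by (intro sets_PiM_cong) auto

lemma distr_gaussian_coordinate:
  "distr gaussian_product borel (\<lambda>\<omega>. \<omega> i) = density lborel (normal_density 0 1)"
proof -
  have "distr gaussian_product borel (\<lambda>\<omega>. \<omega> i) = distr gaussian_product (density lborel (normal_density 0 1)) (\<lambda>\<omega>. \<omega> i)"
    by (intro distr_cong) auto
  also have "\<dots> = density lborel (normal_density 0 1)"
    unfolding gaussian_product_def
    by (rule distr_PiM_component) (auto intro!: prob_space_normal_density)
  finally show ?thesis .
qed

lemma measurable_gaussian_coordinate [measurable]: "(\<lambda>\<omega>. \<omega> i) \<in> borel_measurable gaussian_product"
  by (simp add: measurable_cong_sets[OF sets_gaussian_product refl])

lemma distributed_gaussian_coordinate:
  "distributed gaussian_product lborel (\<lambda>\<omega>. \<omega> i) (normal_density 0 1)"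
proof -
  have "distr gaussian_product lborel (\<lambda>\<omega>. \<omega> i) = distr gaussian_product borel (\<lambda>\<omega>. \<omega> i)"
    by (intro distr_cong) auto
  then show ?thesis unfolding distributed_def distr_gaussian_coordinate by auto
qed

lemma indep_gaussian_coordinates:
  "prob_space.indep_vars gaussian_product (\<lambda>_. borel) (\<lambda>i \<omega>. \<omega> i) UNIV"
proof -
  interpret prob_space gaussian_product by (rule prob_space_gaussian_product)
  have "distr gaussian_product (Pi\<^sub>M UNIV (\<lambda>_. borel)) (\<lambda>\<omega>. \<lambda>i\<in>UNIV. \<omega> i) = distr gaussian_product gaussian_product (\<lambda>\<omega>. \<omega>)"
    by (intro distr_cong) (auto simp: sets_gaussian_product)
  also have "\<dots> = gaussian_product" by (rule distr_id)
  also have "\<dots> = (\<Pi>\<^sub>M i\<in>UNIV. distr gaussian_product borel (\<lambda>\<omega>. \<omega> i))"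
    unfolding distr_gaussian_coordinate by (simp add: gaussian_product_def)
  finally show ?thesis by (subst indep_vars_iff_distr_eq_PiM) auto
qed

lemma gaussian_sum_moments:
  fixes c :: "nat \<Rightarrow> real" and N :: nat
  defines "S \<equiv> \<lambda>\<omega>. \<Sum>i<N. c i * \<omega> i"
  shows "has_bochner_integral gaussian_product (\<lambda>\<omega>. \<bar>S \<omega>\<bar>) (sqrt (2 / pi) * L2_set c {..<N})"
    and "has_bochner_integral gaussian_product (\<lambda>\<omega>. (S \<omega>)\<^sup>2) (\<Sum>i<N. (c i)\<^sup>2)"
proof -
  interpret prob_space gaussian_product by (rule prob_space_gaussian_product)
  define J where "J = {i. i < N \<and> c i \<noteq> 0}"
  have J: "finite J" "J \<subseteq> {..<N}" by (auto simp: J_def)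
  have SJ: "S \<omega> = (\<Sum>i\<in>J. c i * \<omega> i)" for \<omega>
    unfolding S_def using J by (intro sum.mono_neutral_right) (auto simp: J_def)
  have cJ: "(\<Sum>i<N. (c i)\<^sup>2) = (\<Sum>i\<in>J. (c i)\<^sup>2)"
    using J by (intro sum.mono_neutral_right) (auto simp: J_def)
  have "has_bochner_integral gaussian_product (\<lambda>\<omega>. \<bar>S \<omega>\<bar>) (sqrt (2 / pi) * L2_set c {..<N}) \<and>
    has_bochner_integral gaussian_product (\<lambda>\<omega>. (S \<omega>)\<^sup>2) (\<Sum>i<N. (c i)\<^sup>2)"
  proof (cases "J = {}")
    case True
    then show ?thesis unfolding L2_set_def cJ by (simp add: SJ has_bochner_integral_zero)
  next
    case False
    define \<sigma> where "\<sigma> = sqrt (\<Sum>i\<in>J. (c i)\<^sup>2)"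
    have \<sigma>: "0 < \<sigma>" unfolding \<sigma>_def using J False by (intro real_sqrt_gt_zero sum_pos) (auto simp: J_def)
    have "indep_vars (\<lambda>_. borel) (\<lambda>i \<omega>. \<omega> i) J"
      using indep_gaussian_coordinates by (rule indep_vars_subset) auto
    then have "indep_vars (\<lambda>_. borel) (\<lambda>i \<omega>. c i * \<omega> i) J"
      by (rule indep_vars_compose2[where X = "\<lambda>i \<omega>. \<omega> i" and Y = "\<lambda>i x. c i * x"]) auto
    moreover have "distributed gaussian_product lborel (\<lambda>\<omega>. c i * \<omega> i) (normal_density 0 \<bar>c i\<bar>)" if "i \<in> J" for i
      using normal_density_affine[OF distributed_gaussian_coordinate, of "c i" 0 i] that by (simp add: J_def)
    ultimately have "distributed gaussian_product lborel (\<lambda>\<omega>. \<Sum>i\<in>J. c i * \<omega> i)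
        (normal_density (\<Sum>i\<in>J. 0) (sqrt (\<Sum>i\<in>J. \<bar>c i\<bar>\<^sup>2)))"
      using J False by (intro sum_indep_normal) (auto simp: J_def)
    then have dist: "distributed gaussian_product lborel S (normal_density 0 \<sigma>)"
      by (simp add: SJ[abs_def, symmetric] \<sigma>_def)
    have nn: "0 \<le> normal_density 0 \<sigma> x" for x by simp
    have 1: "has_bochner_integral lborel (\<lambda>x. normal_density 0 \<sigma> x * \<bar>x\<bar>) (\<sigma> * sqrt (2 / pi))"
      using normal_moment_abs_odd[OF \<sigma>, of 0 0] by simp
    have 2: "has_bochner_integral lborel (\<lambda>x. normal_density 0 \<sigma> x * x\<^sup>2) (\<sigma>\<^sup>2)"
      using normal_moment_even[OF \<sigma>, of 0 1] \<sigma> by simp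
    have "has_bochner_integral gaussian_product (\<lambda>\<omega>. \<bar>S \<omega>\<bar>) (\<sigma> * sqrt (2 / pi))"
      using 1 distributed_integrable[OF dist _ nn, of abs] distributed_integral[OF dist _ nn, of abs]
      by (auto simp: has_bochner_integral_iff)
    moreover have "has_bochner_integral gaussian_product (\<lambda>\<omega>. (S \<omega>)\<^sup>2) (\<sigma>\<^sup>2)"
      using 2 distributed_integrable[OF dist _ nn, of "\<lambda>x. x\<^sup>2"] distributed_integral[OF dist _ nn, of "\<lambda>x. x\<^sup>2"]
      by (auto simp: has_bochner_integral_iff)
    moreover have "\<sigma>\<^sup>2 = (\<Sum>i<N. (c i)\<^sup>2)" unfolding \<sigma>_def cJ by (simp add: sum_nonneg)
    moreover have "\<sigma> = L2_set c {..<N}" unfolding \<sigma>_def L2_set_def cJ ..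
    ultimately show ?thesis by (simp add: mult.commute)
  qed
  then show "has_bochner_integral gaussian_product (\<lambda>\<omega>. \<bar>S \<omega>\<bar>) (sqrt (2 / pi) * L2_set c {..<N})"
    and "has_bochner_integral gaussian_product (\<lambda>\<omega>. (S \<omega>)\<^sup>2) (\<Sum>i<N. (c i)\<^sup>2)" by auto
qed

text \<open>
  The complex Gaussian variable with coefficients \<open>w\<close>. Its \<open>k\<close>-th basic variable has the real part
  \<open>\<omega> k\<close> and the imaginary part \<open>\<omega> (r + k)\<close>, hence second absolute moment 2.
\<close>
definition gaussian_form :: "nat \<Rightarrow> (nat \<Rightarrow> complex) \<Rightarrow> (nat \<Rightarrow> real) \<Rightarrow> complex" where
  "gaussian_form r w \<omega> = (\<Sum>k<r. w k * Complex (\<omega> k) (\<omega> (r + k)))"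

lemma gaussian_form_parts:
  "Re (gaussian_form r w \<omega>) = (\<Sum>i<r + r. (if i < r then Re (w i) else - Im (w (i - r))) * \<omega> i)"
  "Im (gaussian_form r w \<omega>) = (\<Sum>i<r + r. (if i < r then Im (w i) else Re (w (i - r))) * \<omega> i)"
  unfolding gaussian_form_def sum_lessThan_add by (simp_all add: sum.distrib sum_subtractf sum_negf)

lemma gaussian_form_second_moment:
  "has_bochner_integral gaussian_product (\<lambda>\<omega>. (cmod (gaussian_form r w \<omega>))\<^sup>2) (2 * (enorm r w)\<^sup>2)"
proof -
  have "has_bochner_integral gaussian_product (\<lambda>\<omega>. (Re (gaussian_form r w \<omega>))\<^sup>2 + (Im (gaussian_form r w \<omega>))\<^sup>2)
     ((\<Sum>i<r + r. (if i < r then Re (w i) else - Im (w (i - r)))\<^sup>2) + (\<Sum>i<r + r. (if i < r then Im (w i) else Re (w (i - r)))\<^sup>2))"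
    unfolding gaussian_form_parts by (intro has_bochner_integral_add gaussian_sum_moments)
  also have "(\<lambda>\<omega>. (Re (gaussian_form r w \<omega>))\<^sup>2 + (Im (gaussian_form r w \<omega>))\<^sup>2) = (\<lambda>\<omega>. (cmod (gaussian_form r w \<omega>))\<^sup>2)"
    by (simp add: cmod_power2)
  also have "(\<Sum>i<r + r. (if i < r then Re (w i) else - Im (w (i - r)))\<^sup>2) + (\<Sum>i<r + r. (if i < r then Im (w i) else Re (w (i - r)))\<^sup>2)
     = 2 * (enorm r w)\<^sup>2"
    unfolding sum_lessThan_add enorm_sq cmod_power2 by (simp add: sum.distrib)
  finally show ?thesis .
qed

text \<open>
  The lower bound compares the modulus with the sum of the absolute values of the real and imaginary
  part. It is not sharp: the sharp factor is \<open>sqrt (pi / 2)\<close>, which would give the constant \<open>4 / pi\<close>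
  below.
\<close>
lemma gaussian_form_first_moment:
  "integrable gaussian_product (\<lambda>\<omega>. cmod (gaussian_form r w \<omega>))"
  "2 / sqrt pi * enorm r w \<le> (\<integral>\<omega>. cmod (gaussian_form r w \<omega>) \<partial>gaussian_product)"
proof -
  let ?f = "gaussian_form r w"
  have n1: "L2_set (\<lambda>i. if i < r then Re (w i) else - Im (w (i - r))) {..<r + r} = enorm r w"
    "L2_set (\<lambda>i. if i < r then Im (w i) else Re (w (i - r))) {..<r + r} = enorm r w"
    unfolding L2_set_def enorm_def sum_lessThan_add by (simp_all add: cmod_power2 sum.distrib)
  have re: "has_bochner_integral gaussian_product (\<lambda>\<omega>. \<bar>Re (?f \<omega>)\<bar>) (sqrt (2 / pi) * enorm r w)"
    using gaussian_sum_moments(1)[of "\<lambda>i. if i < r then Re (w i) else - Im (w (i - r))" "r + r"]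
    unfolding gaussian_form_parts n1 .
  have im: "has_bochner_integral gaussian_product (\<lambda>\<omega>. \<bar>Im (?f \<omega>)\<bar>) (sqrt (2 / pi) * enorm r w)"
    using gaussian_sum_moments(1)[of "\<lambda>i. if i < r then Im (w i) else Re (w (i - r))" "r + r"]
    unfolding gaussian_form_parts n1 .
  have sum: "has_bochner_integral gaussian_product (\<lambda>\<omega>. \<bar>Re (?f \<omega>)\<bar> + \<bar>Im (?f \<omega>)\<bar>) (2 * sqrt (2 / pi) * enorm r w)"
    using has_bochner_integral_add[OF re im] by (simp only: mult_2 distrib_right)
  have meas: "(\<lambda>\<omega>. cmod (?f \<omega>)) \<in> borel_measurable gaussian_product"
  proof -
    have [measurable]: "(\<lambda>\<omega>. (cmod (?f \<omega>))\<^sup>2) \<in> borel_measurable gaussian_product"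
      using gaussian_form_second_moment[of r w] by (auto simp: has_bochner_integral_iff)
    have "(\<lambda>\<omega>. sqrt ((cmod (?f \<omega>))\<^sup>2)) \<in> borel_measurable gaussian_product" by measurable
    then show ?thesis by simp
  qed
  show int: "integrable gaussian_product (\<lambda>\<omega>. cmod (?f \<omega>))"
  proof (rule Bochner_Integration.integrable_bound)
    show "integrable gaussian_product (\<lambda>\<omega>. \<bar>Re (?f \<omega>)\<bar> + \<bar>Im (?f \<omega>)\<bar>)" using sum by (simp add: has_bochner_integral_iff)
    show "AE \<omega> in gaussian_product. norm (cmod (?f \<omega>)) \<le> norm (\<bar>Re (?f \<omega>)\<bar> + \<bar>Im (?f \<omega>)\<bar>)"
      using cmod_le by auto
  qed (rule meas)
  have "2 * sqrt (2 / pi) * enorm r w = (\<integral>\<omega>. \<bar>Re (?f \<omega>)\<bar> + \<bar>Im (?f \<omega>)\<bar> \<partial>gaussian_product)"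
    using sum by (simp add: has_bochner_integral_iff)
  also have "\<dots> \<le> (\<integral>\<omega>. sqrt 2 * cmod (?f \<omega>) \<partial>gaussian_product)"
  proof (rule integral_mono)
    show "\<bar>Re (?f \<omega>)\<bar> + \<bar>Im (?f \<omega>)\<bar> \<le> sqrt 2 * cmod (?f \<omega>)" for \<omega>
      by (rule complex_abs_le_norm)
  qed (use sum int in \<open>auto simp: has_bochner_integral_iff\<close>)
  also have "\<dots> = sqrt 2 * (\<integral>\<omega>. cmod (?f \<omega>) \<partial>gaussian_product)" by simp
  finally show "2 / sqrt pi * enorm r w \<le> (\<integral>\<omega>. cmod (?f \<omega>) \<partial>gaussian_product)"
    by (simp add: real_sqrt_divide field_simps)
qed

text \<open>
  Let \<open>T\<close> be the matrix of the vectors \<open>X V\<^sub>k\<close> and \<open>S\<close> the square of its Hilbert--Schmidt norm, which is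
  the pairing to be bounded. With \<open>w j\<close> the columns of \<open>T\<^sup>* X\<close>,
  \<open>S\<close> equals \<open>\<Sum>j k. V k j * w j k\<close>, hence \<open>S \<le> \<Sum>j. \<parallel>w j\<parallel>\<close> because \<open>\<Sum>k. \<bar>V k j\<bar>\<^sup>2 = 1\<close>. Each Euclidean norm is replaced by the mean modulus of a Gaussian combination; pointwise
  these moduli add up to at most \<open>F_norm X * \<parallel>y\<parallel>\<close> with a Gaussian vector \<open>y\<close> whose second moment
  is \<open>2 S\<close>.
\<close>
lemma little_bound_half_pi: "little_bound (pi / 2)"
  unfolding little_bound_def
proof (intro conjI allI impI)
  fix m n :: nat and X :: "complex mat" assume n: "0 < n" and X: "X \<in> carrier_mat m n"
  define F where "F = F_norm X"
  have F: "0 \<le> F" unfolding F_def by (rule F_norm_nonneg[OF X])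
  have "cbF_norm X \<le> sqrt (pi / 2 * F\<^sup>2)"
  proof (rule cbF_norm_le_sqrt[OF X n])
    fix G assume "correlation n G"
    then obtain r and V :: "nat \<Rightarrow> nat \<Rightarrow> complex" where V: "\<forall>i<n. (\<Sum>k<r. (cmod (V k i))\<^sup>2) = 1"
      and G: "\<forall>i<n. \<forall>j<n. G i j = (\<Sum>k<r. cnj (V k i) * V k j)"
      unfolding correlation_def by blast
    define T where "T = (\<lambda>l k. mulv n (entry X) (V k) l)"
    define S where "S = (\<Sum>l<m. \<Sum>k<r. (cmod (T l k))\<^sup>2)"
    have PS: "pairing n (gram m (entry X)) G = S"
    proof -
      have "pairing n (gram m (entry X)) G = (\<Sum>k<r. (enorm m (mulv n (entry X) (V k)))\<^sup>2)"
        using G by (subst pairing_gram[where r = r and V = V]) (auto simp: quad_gram)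
      then show ?thesis unfolding S_def T_def enorm_sq by (subst sum.swap) simp
    qed
    define w where "w = (\<lambda>j k. \<Sum>l<m. entry X l j * cnj (T l k))"
    define y where "y = (\<lambda>\<omega> l. gaussian_form r (\<lambda>k. cnj (T l k)) \<omega>)"
    have "complex_of_real S = (\<Sum>j<n. \<Sum>k<r. V k j * w j k)"
    proof -
      have "complex_of_real S = (\<Sum>l<m. \<Sum>k<r. \<Sum>j<n. V k j * (entry X l j * cnj (T l k)))"
        unfolding S_def of_real_sum complex_norm_square
        by (intro sum.cong refl) (simp add: T_def mulv_def sum_distrib_right algebra_simps)
      also have "\<dots> = (\<Sum>k<r. \<Sum>l<m. \<Sum>j<n. V k j * (entry X l j * cnj (T l k)))" by (rule sum.swap)
      also have "\<dots> = (\<Sum>k<r. \<Sum>j<n. \<Sum>l<m. V k j * (entry X l j * cnj (T l k)))"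
        by (intro sum.cong refl sum.swap)
      also have "\<dots> = (\<Sum>j<n. \<Sum>k<r. \<Sum>l<m. V k j * (entry X l j * cnj (T l k)))" by (rule sum.swap)
      finally show ?thesis unfolding w_def sum_distrib_left .
    qed
    then have "S \<le> cmod (\<Sum>j<n. \<Sum>k<r. V k j * w j k)" by (metis abs_ge_self norm_of_real)
    also have "\<dots> \<le> (\<Sum>j<n. enorm r (w j))"
    proof (rule sum_norm_le)
      fix j assume "j \<in> {..<n}"
      then have "enorm r (\<lambda>k. V k j) = 1" using V by (simp add: enorm_def L2_set_def)
      then show "cmod (\<Sum>k<r. V k j * w j k) \<le> enorm r (w j)"
        using enorm_cauchy_schwarz[of "\<lambda>k. V k j" "w j" r] by simp
    qed
    finally have Sle: "S \<le> (\<Sum>j<n. enorm r (w j))" .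
    have point: "(\<Sum>j<n. cmod (gaussian_form r (w j) \<omega>)) \<le> F * enorm m (y \<omega>)" for \<omega>
    proof -
      have wy: "gaussian_form r (w j) \<omega> = (\<Sum>l<m. entry X l j * y \<omega> l)" for j
        unfolding y_def gaussian_form_def w_def sum_distrib_left sum_distrib_right
        by (subst sum.swap) (simp add: mult.assoc)
      define s where "s = (\<lambda>j. cnj (sgn (gaussian_form r (w j) \<omega>)))"
      have s: "cmod (s j) \<le> 1" for j by (simp add: s_def norm_sgn)
      have "complex_of_real (\<Sum>j<n. cmod (gaussian_form r (w j) \<omega>)) = (\<Sum>j<n. s j * gaussian_form r (w j) \<omega>)"
        unfolding of_real_sum s_def sgn_eq
        by (intro sum.cong refl) (simp add: complex_norm_square[symmetric] power2_eq_square mult.commute[of "cnj _"])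
      also have "\<dots> = (\<Sum>l<m. y \<omega> l * mulv n (entry X) s l)"
        unfolding wy mulv_def sum_distrib_left by (subst sum.swap) (simp add: algebra_simps)
      finally have "(\<Sum>j<n. cmod (gaussian_form r (w j) \<omega>)) \<le> cmod (\<Sum>l<m. y \<omega> l * mulv n (entry X) s l)"
        by (metis abs_ge_self norm_of_real)
      also have "\<dots> \<le> enorm m (y \<omega>) * enorm m (mulv n (entry X) s)" by (rule enorm_cauchy_schwarz)
      also have "\<dots> \<le> enorm m (y \<omega>) * F"
        unfolding F_def using s by (intro mult_left_mono F_norm_upper_unit[OF X]) auto
      finally show ?thesis by (simp add: mult.commute)
    qed
    define a where "a = sqrt pi"
    have a: "0 < a" "a\<^sup>2 = pi" by (auto simp: a_def)
    \<comment> \<open>The arithmetic-geometric mean inequality with the factor \<open>a\<close> that optimises the final constant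
        replaces the product by a sum with an explicit expectation.\<close>
    have point2: "2 * (\<Sum>j<n. cmod (gaussian_form r (w j) \<omega>)) \<le> a * F\<^sup>2 + (1 / a) * (\<Sum>l<m. (cmod (y \<omega> l))\<^sup>2)" for \<omega>
    proof -
      define E where "E = enorm m (y \<omega>)"
      have "a * (a * F\<^sup>2 + (1 / a) * E\<^sup>2) = (a * F)\<^sup>2 + E\<^sup>2"
        using a(1) by (simp add: distrib_left power2_eq_square)
      moreover have "a * (2 * (F * E)) = 2 * (a * F) * E" by simp
      ultimately have "a * (2 * (F * E)) \<le> a * (a * F\<^sup>2 + (1 / a) * E\<^sup>2)"
        using sum_squares_bound[of "a * F" E] by linarith
      then have "2 * (F * E) \<le> a * F\<^sup>2 + (1 / a) * E\<^sup>2" using a by simp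
      then show ?thesis using point[of \<omega>] unfolding E_def enorm_sq by linarith
    qed
    have "2 * (2 / a * S) \<le> 2 * (\<Sum>j<n. 2 / a * enorm r (w j))"
      unfolding sum_distrib_left[symmetric] using Sle a(1) by (intro mult_left_mono) auto
    also have "\<dots> \<le> 2 * (\<Sum>j<n. \<integral>\<omega>. cmod (gaussian_form r (w j) \<omega>) \<partial>gaussian_product)"
      unfolding a_def by (intro mult_left_mono sum_mono gaussian_form_first_moment) auto
    also have "\<dots> = (\<integral>\<omega>. 2 * (\<Sum>j<n. cmod (gaussian_form r (w j) \<omega>)) \<partial>gaussian_product)"
      by (simp add: gaussian_form_first_moment(1))
    also have "\<dots> \<le> (\<integral>\<omega>. a * F\<^sup>2 + (1 / a) * (\<Sum>l<m. (cmod (y \<omega> l))\<^sup>2) \<partial>gaussian_product)"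
    proof (rule integral_mono)
      interpret prob_space gaussian_product by (rule prob_space_gaussian_product)
      show "integrable gaussian_product (\<lambda>\<omega>. a * F\<^sup>2 + (1 / a) * (\<Sum>l<m. (cmod (y \<omega> l))\<^sup>2))"
        using gaussian_form_second_moment unfolding y_def
        by (intro Bochner_Integration.integrable_add integrable_const integrable_mult_right Bochner_Integration.integrable_sum) (auto simp: has_bochner_integral_iff)
    qed (use point2 gaussian_form_first_moment(1) in auto)
    also have "\<dots> = a * F\<^sup>2 + (1 / a) * (2 * S)"
    proof -
      interpret prob_space gaussian_product by (rule prob_space_gaussian_product)
      have "has_bochner_integral gaussian_product (\<lambda>\<omega>. \<Sum>l<m. (cmod (y \<omega> l))\<^sup>2) (\<Sum>l<m. 2 * (enorm r (\<lambda>k. cnj (T l k)))\<^sup>2)"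
        unfolding y_def by (intro has_bochner_integral_sum gaussian_form_second_moment)
      also have "(\<Sum>l<m. 2 * (enorm r (\<lambda>k. cnj (T l k)))\<^sup>2) = 2 * S"
        by (simp add: S_def enorm_sq sum_distrib_left)
      finally show ?thesis by (simp add: has_bochner_integral_iff prob_space)
    qed
    finally have "a * (4 / a * S) \<le> a * (a * F\<^sup>2 + (1 / a) * (2 * S))" using a by (intro mult_left_mono) auto
    then have "4 * S \<le> a\<^sup>2 * F\<^sup>2 + 2 * S" using a(1) by (simp add: distrib_left power2_eq_square)
    then show "pairing n (gram m (entry X)) G \<le> pi / 2 * F\<^sup>2" unfolding PS a(2) by simp
  qed
  also have "\<dots> = sqrt (pi / 2) * F_norm X" using F unfolding F_def real_sqrt_mult by simp
  finally show "cbF_norm X \<le> sqrt (pi / 2) * F_norm X" .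
qed simp

section \<open>The two constants\<close>

lemma schur_norm_one_pos: "0 < schur_norm (1\<^sub>m 1)"
proof -
  have eq: "schur_product (1\<^sub>m 1) (1\<^sub>m 1) = (1\<^sub>m 1 :: complex mat)"
    by (rule eq_matI) (auto simp: schur_product_def)
  have one: "(1\<^sub>m 1 :: complex mat) \<in> carrier_mat 1 1" by simp
  have "op_norm (1\<^sub>m 1) \<le> 1"
    by (rule op_norm_least[OF one]) (auto simp: mulv_def enorm_def L2_set_def)
  then have "op_norm (1\<^sub>m 1) \<le> schur_norm (1\<^sub>m 1)"
    using schur_norm_upper[OF one one] unfolding eq by simp
  moreover have "1 \<le> op_norm (1\<^sub>m 1)"
    using norm_entry_le_op_norm[OF one, of 0 0] by simp
  ultimately show ?thesis by linarith
qed

text \<open>The constant \<open>K\<close> is admissible in the Grothendieck inequality.\<close>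
definition grothendieck_bound :: "real \<Rightarrow> bool" where
  "grothendieck_bound K \<longleftrightarrow> (\<forall>m n X. 0 < m \<longrightarrow> 0 < n \<longrightarrow> X \<in> carrier_mat m n \<longrightarrow>
     projective_norm X \<le> K * schur_norm X)"

lemma grothendieck_boundD:
  "grothendieck_bound K \<Longrightarrow> 0 < m \<Longrightarrow> 0 < n \<Longrightarrow> X \<in> carrier_mat m n \<Longrightarrow>
    projective_norm X \<le> K * schur_norm X"
  by (simp add: grothendieck_bound_def)

text \<open>Nonnegativity of \<open>K\<close>, a part of \<open>little_bound\<close>, comes from the one by one matrix 1.\<close>
lemma little_bound_of_grothendieck_bound:
  assumes K: "grothendieck_bound K"
  shows "little_bound K"
proof -
  have one: "(1\<^sub>m 1 :: complex mat) \<in> carrier_mat 1 1" by simp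
  have "projective_norm (1\<^sub>m 1) \<le> K * schur_norm (1\<^sub>m 1)"
    by (rule grothendieck_boundD[OF K _ _ one]) simp_all
  then have "0 \<le> K * schur_norm (1\<^sub>m 1)" using projective_norm_nonneg[OF one] by linarith
  then have "0 \<le> K" using schur_norm_one_pos by (simp add: zero_le_mult_iff)
  then show ?thesis
    unfolding little_bound_def
    by (intro conjI allI impI, assumption)
      (rule cbF_norm_le_of_projective_norm_le, assumption, rule grothendieck_boundD[OF K])
qed

theorem theorem4p2:
  shows "little_grothendieck_constant \<le> grothendieck_constant \<and>
    grothendieck_constant \<le> little_grothendieck_constant / (2 - little_grothendieck_constant)"
proof -
  define L where "L = {k. little_bound k}"
  define KK where "KK = {K. grothendieck_bound K}"
  define k0 where "k0 = Inf L"
  have k0: "little_grothendieck_constant = k0"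
    unfolding little_grothendieck_constant_def k0_def L_def little_bound_def ..
  have K0: "grothendieck_constant = Inf KK"
    unfolding grothendieck_constant_def KK_def grothendieck_bound_def ..
  have L_nonneg: "0 \<le> k" if "k \<in> L" for k using that by (simp add: L_def little_bound_def)
  have bddL: "bdd_below L" using L_nonneg by (rule bdd_belowI)
  have half_pi: "pi / 2 \<in> L" using little_bound_half_pi by (simp add: L_def)
  have k0_le: "k0 \<le> k" if "k \<in> L" for k unfolding k0_def using that by (rule cInf_lower[OF _ bddL])
  have k0_nonneg: "0 \<le> k0" unfolding k0_def using half_pi L_nonneg by (intro cInf_greatest) auto
  have k0_less: "k0 < 2" using k0_le[OF half_pi] pi_less_4 by simp
  have sub: "KK \<subseteq> L" using little_bound_of_grothendieck_bound by (auto simp: KK_def L_def)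
  have inKK: "k / (2 - k) \<in> KK" if "k \<in> L" "k < 2" for k
    using that projective_norm_le_schur_norm unfolding KK_def L_def grothendieck_bound_def by simp
  \<comment> \<open>Admissibility is a closed condition, so the infimum is attained.\<close>
  have "k0 \<in> L"
    unfolding L_def little_bound_def mem_Collect_eq
  proof (intro conjI allI impI k0_nonneg)
    fix m n :: nat and X :: "complex mat" assume mn: "0 < m" "0 < n" and X: "X \<in> carrier_mat m n"
    have "((\<lambda>k. sqrt k * F_norm X) \<longlongrightarrow> sqrt k0 * F_norm X) (at_right k0)"
      by (intro tendsto_intros)
    moreover have "\<forall>\<^sub>F k in at_right k0. cbF_norm X \<le> sqrt k * F_norm X"
      unfolding eventually_at_right_field
    proof (intro exI[of _ "k0 + 1"] conjI allI impI)
      fix k assume k: "k0 < k"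
      then obtain k' where k': "k' \<in> L" "k' < k"
        using cInf_lessD[of L k] half_pi unfolding k0_def by auto
      then have "cbF_norm X \<le> sqrt k' * F_norm X" using little_boundD mn X by (simp add: L_def)
      also have "\<dots> \<le> sqrt k * F_norm X" using k' F_norm_nonneg[OF X] by (intro mult_right_mono) auto
      finally show "cbF_norm X \<le> sqrt k * F_norm X" .
    qed simp
    ultimately show "cbF_norm X \<le> sqrt k0 * F_norm X"
      by (rule tendsto_lowerbound) simp
  qed
  then have in0: "k0 / (2 - k0) \<in> KK" using k0_less by (rule inKK)
  have "bdd_below KK" using bddL sub by (rule bdd_below_mono)
  then have "Inf KK \<le> k0 / (2 - k0)" using in0 by (intro cInf_lower)
  moreover have "k0 \<le> Inf KK" using in0 sub k0_le by (intro cInf_greatest) auto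
  ultimately show ?thesis unfolding k0 K0 by blast
qed

end
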